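(* Let $I\subset S=K[x_1,\ldots,x_n]$ be a nonzero proper monomial ideal of Borel type and let $q$ be a positive integer. Then $$\operatorname{reg}(I^{((q))})\leq q\cdot \operatorname{reg}(I),$$ where $I^{((q))}$ is the $q$-th quasi-symbolic power of $I$.
   Context: $K$ is an infinite field and $S=K[x_1,\ldots,x_n]$, $n\geq 2$, is the polynomial ring with the standard grading. Borel type: a monomial ideal $I\subset S$ is of Borel type if $(I:x_j^\infty)=(I:(x_1,\ldots,x_j)^\infty)$ for all $j=1,\ldots,n$, where $(I:J^\infty)=\bigcup_{k\ge 0}(I:J^k)$. Canonical presentation: an irreducible monomial ideal is a monomial ideal generated by positive powers of some of the variables. Every monomial ideal $I$ has a unique irredundant decomposition $I=\bigcap_{i=1}^s C_i$ into irreducible monomial ideals. Let $P_1,\ldots,P_r$ be the distinct primes among the radicals $\sqrt{C_1},\ldots,\sqrt{C_s}$, and let $Q_i$ be the intersection of all $C_j$ with $\sqrt{C_j}=P_i$. Then $Q_i$ is $P_i$-primary and $I=\bigcap_{i=1}^r Q_i$ is called the canonical presentation of $I$ as an intersection of primary ideals. Quasi-symbolic power: for a positive integer $q$, $I^{((q))}:=\bigcap_{i=1}^r Q_i^q$, where $I=\bigcap_{i=1}^r Q_i$ is the canonical presentation and $Q_i^q$ is the ordinary $q$-th power. Regularity: for a finitely generated graded $S$-module $M$, $\operatorname{reg}(M)=\max_{i,j}\{j-i:\beta_{ij}(M)\neq 0\}$, where $\beta_{ij}(M)=\dim_K \operatorname{Tor}_i^S(K,M)_j$. Here $\operatorname{reg}(I)$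 is the regularity of the ideal $I$ as an $S$-module. *)

theory Defs
  imports Complex_Main "HOL-Library.Poly_Mapping" "HOL-Library.Cardinality"
begin

section \<open>The polynomial ring and its ideals\<close>

text \<open>
  The polynomial ring \<open>S = K[x\<^sub>1, \<dots>, x\<^sub>n]\<close>: the index type \<open>'n\<close> of the variables is a finite linear
  order, so \<open>n = CARD('n)\<close> and the order of \<open>'n\<close> is the order \<open>x\<^sub>1, \<dots>, x\<^sub>n\<close> of the variables.
\<close>
type_synonym ('n, 'k) mpoly = "('n \<Rightarrow>\<^sub>0 nat) \<Rightarrow>\<^sub>0 'k"

definition monomial :: "('n \<Rightarrow>\<^sub>0 nat) \<Rightarrow> ('n, 'k::field) mpoly" where
  "monomial m = Poly_Mapping.single m 1"

definition var :: "'n \<Rightarrow> ('n, 'k::field) mpoly" where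
  "var i = monomial (Poly_Mapping.single i 1)"

definition const :: "'k::field \<Rightarrow> ('n, 'k) mpoly" where
  "const c = Poly_Mapping.single 0 c"

definition mdeg :: "('n::finite \<Rightarrow>\<^sub>0 nat) \<Rightarrow> nat" where
  "mdeg m = (\<Sum>i\<in>UNIV. Poly_Mapping.lookup m i)"

text \<open>A commutative ring is a module over itself, and the ideal generated by a set is its span.\<close>

definition ideal_gen :: "'a::comm_ring_1 set \<Rightarrow> 'a set" where
  "ideal_gen A = module.span (*) A"

definition ideal_mult :: "'a::comm_ring_1 set \<Rightarrow> 'a set \<Rightarrow> 'a set" where
  "ideal_mult I J = ideal_gen {f * g | f g. f \<in> I \<and> g \<in> J}"

fun ideal_power :: "'a::comm_ring_1 set \<Rightarrow> nat \<Rightarrow> 'a set" where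
  "ideal_power I 0 = UNIV"
| "ideal_power I (Suc k) = ideal_mult I (ideal_power I k)"

definition colon :: "'a::comm_ring_1 set \<Rightarrow> 'a set \<Rightarrow> 'a set" where
  "colon I J = {f. \<forall>g\<in>J. f * g \<in> I}"

definition saturation :: "'a::comm_ring_1 set \<Rightarrow> 'a set \<Rightarrow> 'a set" where
  "saturation I J = (\<Union>k. colon I (ideal_power J k))"

definition radical :: "'a::comm_ring_1 set \<Rightarrow> 'a set" where
  "radical I = {f. \<exists>k. f ^ k \<in> I}"

section \<open>Monomial ideals\<close>

definition monomial_ideal :: "('n, 'k::field) mpoly set \<Rightarrow> bool" where
  "monomial_ideal I \<longleftrightarrow> (\<exists>A. I = ideal_gen (monomial ` A))"

definition borel_type :: "('n::{finite,linorder}, 'k::field) mpoly set \<Rightarrow> bool" where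
  "borel_type I \<longleftrightarrow> monomial_ideal I \<and>
     (\<forall>j. saturation I (ideal_gen {var j}) = saturation I (ideal_gen (var ` {..j})))"

text \<open>The empty set of variables gives the zero ideal.\<close>
definition irreducible_monomial_ideal :: "('n, 'k::field) mpoly set \<Rightarrow> bool" where
  "irreducible_monomial_ideal C \<longleftrightarrow>
     (\<exists>V e. (\<forall>i\<in>V. 0 < e i) \<and> C = ideal_gen ((\<lambda>i. var i ^ e i) ` V))"

definition irredundant_decomposition ::
    "('n, 'k::field) mpoly set \<Rightarrow> ('n, 'k) mpoly set set \<Rightarrow> bool" where
  "irredundant_decomposition I \<C> \<longleftrightarrow>
     finite \<C> \<and> (\<forall>C\<in>\<C>. irreducible_monomial_ideal C) \<and>
     \<Inter>\<C> = I \<and> (\<forall>C\<in>\<C>. \<Inter>(\<C> - {C}) \<noteq> I)"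

definition irreducible_components ::
    "('n, 'k::field) mpoly set \<Rightarrow> ('n, 'k) mpoly set set" where
  "irreducible_components I = (THE \<C>. irredundant_decomposition I \<C>)"

definition canonical_presentation ::
    "('n, 'k::field) mpoly set \<Rightarrow> ('n, 'k) mpoly set set" where
  "canonical_presentation I =
     (\<lambda>P. \<Inter>{C \<in> irreducible_components I. radical C = P}) ` (radical ` irreducible_components I)"

definition quasi_symbolic_power :: "('n, 'k::field) mpoly set \<Rightarrow> nat \<Rightarrow> ('n, 'k) mpoly set" where
  "quasi_symbolic_power I q = (\<Inter>Q\<in>canonical_presentation I. ideal_power Q q)"

section \<open>Graded complexes of free modules and \<open>Tor\<close>\<close>

text \<open>
  The free module on a set \<open>B\<close> of basis elements consists of the \<open>v :: 'b \<Rightarrow>\<^sub>0 ('n, 'k) mpoly\<close> with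
  \<open>keys v \<subseteq> B\<close>. A complex \<open>\<dots> \<rightarrow> F\<^sub>2 \<rightarrow> F\<^sub>1 \<rightarrow> F\<^sub>0 \<rightarrow> 0\<close> of graded free modules is given by the basis of
  each \<open>F\<^sub>i\<close>, the degrees of the basis elements, and the image in \<open>F\<^sub>i\<^sub>-\<^sub>1\<close> of each basis element
  of \<open>F\<^sub>i\<close> for \<open>i \<ge> 1\<close>.
\<close>
record (overloaded) ('b, 'n, 'k) free_complex =
  basis :: "nat \<Rightarrow> 'b set"
  bdeg :: "nat \<Rightarrow> 'b \<Rightarrow> nat"
  bdry :: "nat \<Rightarrow> 'b \<Rightarrow> ('b \<Rightarrow>\<^sub>0 ('n, 'k) mpoly)"

definition smult :: "('n, 'k::field) mpoly \<Rightarrow> ('b \<Rightarrow>\<^sub>0 ('n, 'k) mpoly) \<Rightarrow> ('b \<Rightarrow>\<^sub>0 ('n, 'k) mpoly)" where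
  "smult f v = Poly_Mapping.map ((*) f) v"

definition cscale :: "'k::field \<Rightarrow> ('b \<Rightarrow>\<^sub>0 ('n, 'k) mpoly) \<Rightarrow> ('b \<Rightarrow>\<^sub>0 ('n, 'k) mpoly)" where
  "cscale c = smult (const c)"

definition differential ::
    "('b, 'n, 'k::field) free_complex \<Rightarrow> nat \<Rightarrow> ('b \<Rightarrow>\<^sub>0 ('n, 'k) mpoly) \<Rightarrow> ('b \<Rightarrow>\<^sub>0 ('n, 'k) mpoly)" where
  "differential F i v =
     (\<Sum>b\<in>Poly_Mapping.keys v. smult (Poly_Mapping.lookup v b) (bdry F i b))"

text \<open>
  The degree \<open>j\<close> part of \<open>F\<^sub>i \<otimes>\<^sub>S I\<close> for an ideal \<open>I\<close>. As \<open>F\<^sub>i\<close> is free, \<open>F\<^sub>i \<otimes>\<^sub>S I\<close> is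
  the set of elements of \<open>F\<^sub>i\<close> with all coefficients in \<open>I\<close>, and the differential of \<open>F \<otimes>\<^sub>S I\<close> is
  the restriction of that of \<open>F\<close>. For \<open>I = UNIV\<close> this is \<open>F\<close> itself.
\<close>
definition chains ::
    "('b, 'n::finite, 'k::field) free_complex \<Rightarrow> ('n, 'k) mpoly set \<Rightarrow> nat \<Rightarrow> nat
      \<Rightarrow> ('b \<Rightarrow>\<^sub>0 ('n, 'k) mpoly) set" where
  "chains F I i j =
     {v. Poly_Mapping.keys v \<subseteq> basis F i \<and>
         (\<forall>b\<in>basis F i. Poly_Mapping.lookup v b \<in> I \<and>
            (\<forall>m\<in>Poly_Mapping.keys (Poly_Mapping.lookup v b). mdeg m + bdeg F i b = j))}"

definition cycles ::
    "('b, 'n::finite, 'k::field) free_complex \<Rightarrow> ('n, 'k) mpoly set \<Rightarrow> nat \<Rightarrow> nat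
      \<Rightarrow> ('b \<Rightarrow>\<^sub>0 ('n, 'k) mpoly) set" where
  "cycles F I i j = {v \<in> chains F I i j. i = 0 \<or> differential F i v = 0}"

definition boundaries ::
    "('b, 'n::finite, 'k::field) free_complex \<Rightarrow> ('n, 'k) mpoly set \<Rightarrow> nat \<Rightarrow> nat
      \<Rightarrow> ('b \<Rightarrow>\<^sub>0 ('n, 'k) mpoly) set" where
  "boundaries F I i j = differential F (Suc i) ` chains F I (Suc i) j"

text \<open>
  \<open>F\<close> is a graded resolution, by free modules of finite rank, of \<open>K = S/(x\<^sub>1, \<dots>, x\<^sub>n)\<close>. An augmentation
  \<open>F\<^sub>0 \<rightarrow> K\<close> of degree \<open>0\<close> sends a basis element \<open>b\<close> to a scalar \<open>\<epsilon> b\<close>, which vanishes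
  unless \<open>b\<close> has degree \<open>0\<close>, and \<open>f \<in> S\<close> acts on \<open>K\<close> by its constant coefficient.
\<close>
definition resolves_field :: "('b, 'n::finite, 'k::field) free_complex \<Rightarrow> bool" where
  "resolves_field F \<longleftrightarrow>
     (\<forall>i. finite (basis F i)) \<and>
     (\<forall>i. \<forall>b\<in>basis F (Suc i). bdry F (Suc i) b \<in> chains F UNIV i (bdeg F (Suc i) b)) \<and>
     (\<forall>i j. cycles F UNIV (Suc i) j = boundaries F UNIV (Suc i) j) \<and>
     (\<exists>\<epsilon>. (\<exists>b\<in>basis F 0. \<epsilon> b \<noteq> 0) \<and> (\<forall>b\<in>basis F 0. \<epsilon> b \<noteq> 0 \<longrightarrow> bdeg F 0 b = 0) \<and>
       (\<forall>j. {v \<in> chains F UNIV 0 j.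
               (\<Sum>b\<in>Poly_Mapping.keys v. \<epsilon> b * Poly_Mapping.lookup (Poly_Mapping.lookup v b) 0) = 0}
             = boundaries F UNIV 0 j))"

text \<open>
  If \<open>F\<close> resolves \<open>K\<close>, then \<open>Tor\<^sub>i(K, I)\<^sub>j\<close> is the quotient of the cycles of \<open>F \<otimes>\<^sub>S I\<close> by the
  boundaries in homological degree \<open>i\<close> and internal degree \<open>j\<close>. Both are finite-dimensional
  \<open>K\<close>-spaces and the boundaries are contained in the cycles, so the dimension of the quotient
  is the difference of the dimensions.
\<close>
definition tor_dim ::
    "('b, 'n::finite, 'k::field) free_complex \<Rightarrow> ('n, 'k) mpoly set \<Rightarrow> nat \<Rightarrow> nat \<Rightarrow> nat" where
  "tor_dim F I i j =
     vector_space.dim cscale (cycles F I i j) - vector_space.dim cscale (boundaries F I i j)"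

section \<open>The Koszul resolution, Betti numbers and regularity\<close>

text \<open>
  The Koszul complex of \<open>x\<^sub>1, \<dots>, x\<^sub>n\<close>, with basis elements \<open>e\<^sub>\<sigma>\<close> indexed by the sets \<open>\<sigma>\<close> of variables.
  \<open>Tor\<close> does not depend on the choice of the resolution of \<open>K\<close>; we compute it from the Koszul
  complex, which is a resolution of \<open>K\<close> by theorem \<open>koszul_resolves_field\<close> below.
\<close>
definition koszul_sign :: "'n::linorder \<Rightarrow> 'n set \<Rightarrow> 'k::field" where
  "koszul_sign l \<sigma> = (-1) ^ card {i\<in>\<sigma>. i < l}"

definition koszul :: "('n::{finite,linorder} set, 'n, 'k::field) free_complex" where
  "koszul = \<lparr> basis = (\<lambda>i. {\<sigma>. card \<sigma> = i}),
              bdeg = (\<lambda>i \<sigma>. card \<sigma>),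
              bdry = (\<lambda>i \<sigma>. \<Sum>l\<in>\<sigma>. Poly_Mapping.single (\<sigma> - {l}) (const (koszul_sign l \<sigma>) * var l)) \<rparr>"

definition betti :: "('n::{finite,linorder}, 'k::field) mpoly set \<Rightarrow> nat \<Rightarrow> nat \<Rightarrow> nat" where
  "betti I i j = tor_dim koszul I i j"

definition reg :: "('n::{finite,linorder}, 'k::field) mpoly set \<Rightarrow> int" where
  "reg I = Max {int j - int i | i j. betti I i j \<noteq> 0}"

subsection \<open>The choices above are justified\<close>

lemma module_mult: "module ((*) :: 'a::comm_ring_1 \<Rightarrow> 'a \<Rightarrow> 'a)"
  by unfold_locales (auto simp: algebra_simps)

lemma lookup_smult [simp]: "Poly_Mapping.lookup (smult f v) b = f * Poly_Mapping.lookup v b"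
  unfolding smult_def by (simp add: Poly_Mapping.map.rep_eq when_def)

lemma const_add: "const (a + b) = const a + const b"
  by (simp add: const_def single_add)

lemma const_mult: "const (a * b) = const a * const b"
  by (simp add: const_def mult_single)

lemma const_one: "const 1 = 1"
  by (simp add: const_def)

lemma vector_space_cscale: "vector_space cscale"
  by unfold_locales
    (auto intro!: poly_mapping_eqI
      simp: cscale_def lookup_add algebra_simps const_add const_mult const_one)

lemma lookup_mult_single:
  fixes p :: "('n, 'k::field) mpoly"
  shows "Poly_Mapping.lookup (p * (const c * var l)) m =
    (if 0 < Poly_Mapping.lookup m l
     then c * Poly_Mapping.lookup p (m - Poly_Mapping.single l 1) else 0)"
proof -
  let ?s = "Poly_Mapping.single l (1::nat)"
  have e: "m = ?s + q \<longleftrightarrow> 0 < Poly_Mapping.lookup m l \<and> q = m - ?s" for q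
    by (auto simp: poly_mapping_eq_iff fun_eq_iff lookup_add lookup_minus lookup_single when_def
        split: if_splits)
  have "Poly_Mapping.lookup (p * (const c * var l)) m = Poly_Mapping.lookup (Poly_Mapping.single ?s c * p) m"
    by (simp add: const_def var_def monomial_def mult_single mult.commute)
  also have "\<dots> = (\<Sum>k. (c when ?s = k) * (\<Sum>q. Poly_Mapping.lookup p q when m = k + q))"
    by (simp add: lookup_mult lookup_single)
  also have "\<dots> = c * (\<Sum>q. Poly_Mapping.lookup p q when m = ?s + q)"
    by (simp add: when_mult)
  also have "\<dots> = (if 0 < Poly_Mapping.lookup m l then c * Poly_Mapping.lookup p (m - ?s) else 0)"
    unfolding e by (cases "0 < Poly_Mapping.lookup m l") simp_all
  finally show ?thesis .
qed

lemma koszul_sign_insert: "koszul_sign l (insert l \<sigma>) = koszul_sign l \<sigma>"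
  unfolding koszul_sign_def by (rule arg_cong[where f = "\<lambda>A. _ ^ card A"]) auto

lemma lookup_koszul_differential:
  fixes v :: "'n::{finite,linorder} set \<Rightarrow>\<^sub>0 ('n, 'k::field) mpoly"
  shows "Poly_Mapping.lookup (Poly_Mapping.lookup (differential koszul i v) \<tau>) m =
    (\<Sum>l\<in>UNIV. if l \<notin> \<tau> \<and> 0 < Poly_Mapping.lookup m l
       then koszul_sign l \<tau> *
         Poly_Mapping.lookup (Poly_Mapping.lookup v (insert l \<tau>)) (m - Poly_Mapping.single l 1)
       else 0)"
proof -
  let ?a = "\<lambda>l \<sigma>. const (koszul_sign l \<sigma>) * var l :: ('n, 'k) mpoly"
  have "Poly_Mapping.lookup (differential koszul i v) \<tau> =
      (\<Sum>\<sigma>\<in>Poly_Mapping.keys v. Poly_Mapping.lookup v \<sigma> * (\<Sum>l\<in>\<sigma>. ?a l \<sigma> when \<sigma> - {l} = \<tau>))"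
    by (simp add: differential_def koszul_def lookup_sum lookup_single)
  also have "\<dots> = (\<Sum>\<sigma>\<in>UNIV. Poly_Mapping.lookup v \<sigma> * (\<Sum>l\<in>\<sigma>. ?a l \<sigma> when \<sigma> - {l} = \<tau>))"
    by (rule sum.mono_neutral_left) (auto simp: in_keys_iff)
  also have "\<dots> = (\<Sum>\<sigma>\<in>UNIV. \<Sum>l\<in>UNIV. if l \<in> \<sigma> \<and> \<sigma> - {l} = \<tau> then Poly_Mapping.lookup v \<sigma> * ?a l \<sigma> else 0)"
    unfolding sum_distrib_left
    by (rule sum.cong[OF refl], rule sum.mono_neutral_cong_left) (auto simp: when_def)
  also have "\<dots> = (\<Sum>l\<in>UNIV. \<Sum>\<sigma>\<in>UNIV. if \<sigma> = insert l \<tau> then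
      (if l \<notin> \<tau> then Poly_Mapping.lookup v \<sigma> * ?a l \<sigma> else 0) else 0)"
    by (subst sum.swap) (intro sum.cong refl, auto)
  also have "\<dots> = (\<Sum>l\<in>UNIV. if l \<notin> \<tau> then Poly_Mapping.lookup v (insert l \<tau>) * ?a l (insert l \<tau>) else 0)"
    by (intro sum.cong refl) simp
  finally show ?thesis
    by (simp add: lookup_sum if_distrib[of "\<lambda>p. Poly_Mapping.lookup p m"] lookup_mult_single
        koszul_sign_insert if_if_eq_conj cong: if_cong)
qed

lemma koszul_sign_insert_other:
  assumes "l \<notin> \<sigma>" "l \<noteq> k"
  shows "(koszul_sign k (insert l \<sigma>) :: 'k::field) =
    (if l < k then - koszul_sign k \<sigma> else koszul_sign k (\<sigma> :: 'n::{finite,linorder} set))"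
proof -
  have "{i \<in> insert l \<sigma>. i < k} = (if l < k then insert l {i\<in>\<sigma>. i < k} else {i\<in>\<sigma>. i < k})"
    by auto
  then show ?thesis using assms by (simp add: koszul_sign_def)
qed

lemma koszul_sign_min:
  assumes "\<And>i. i \<in> \<sigma> \<Longrightarrow> l \<le> i"
  shows "(koszul_sign l \<sigma> :: 'k::field) = 1"
proof -
  have "{i\<in>\<sigma>. i < l} = {}" using assms by force
  then show ?thesis by (simp only: koszul_sign_def) simp
qed

lemma chains_koszul_iff:
  "v \<in> chains koszul UNIV i j \<longleftrightarrow>
    (\<forall>\<tau> m. Poly_Mapping.lookup (Poly_Mapping.lookup v \<tau>) m \<noteq> 0 \<longrightarrow> card \<tau> = i \<and> mdeg m + i = j)"
    (is "?L \<longleftrightarrow> ?R")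
proof
  assume L: ?L
  show ?R
  proof (intro allI impI)
    fix \<tau> m assume nz: "Poly_Mapping.lookup (Poly_Mapping.lookup v \<tau>) m \<noteq> 0"
    then have "\<tau> \<in> Poly_Mapping.keys v" by (auto simp: in_keys_iff)
    with L nz show "card \<tau> = i \<and> mdeg m + i = j"
      by (auto simp: chains_def koszul_def in_keys_iff subset_iff)
  qed
next
  assume R: ?R
  have "card \<tau> = i" if "\<tau> \<in> Poly_Mapping.keys v" for \<tau>
  proof -
    from that have "Poly_Mapping.lookup v \<tau> \<noteq> 0" by (simp add: in_keys_iff)
    then obtain m where "Poly_Mapping.lookup (Poly_Mapping.lookup v \<tau>) m \<noteq> 0"
      by (metis poly_mapping_eqI lookup_zero)
    with R show ?thesis by blast
  qed
  with R show ?L by (auto simp: chains_def koszul_def in_keys_iff)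
qed

lemma mdeg_add_single: "mdeg (m + Poly_Mapping.single l 1) = Suc (mdeg m)"
  by (simp add: mdeg_def lookup_add lookup_single sum.distrib when_def)

lemma diff_add_single:
  assumes "0 < Poly_Mapping.lookup m l"
  shows "m - Poly_Mapping.single l (1::nat) + Poly_Mapping.single l 1 = m"
  using assms by (intro poly_mapping_eqI) (auto simp: lookup_add lookup_minus lookup_single when_def)

lemma differential_koszul_chains:
  assumes v: "v \<in> chains koszul UNIV (Suc i) j"
  shows "differential koszul k v \<in> chains koszul UNIV i j"
  unfolding chains_koszul_iff
proof (intro allI impI)
  fix \<tau> m
  assume "Poly_Mapping.lookup (Poly_Mapping.lookup (differential koszul k v) \<tau>) m \<noteq> 0"
  then obtain l where "(if l \<notin> \<tau> \<and> 0 < Poly_Mapping.lookup m l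
       then koszul_sign l \<tau> *
         Poly_Mapping.lookup (Poly_Mapping.lookup v (insert l \<tau>)) (m - Poly_Mapping.single l 1)
       else 0) \<noteq> 0"
    unfolding lookup_koszul_differential by (rule sum.not_neutral_contains_not_neutral)
  then have l: "l \<notin> \<tau>" "0 < Poly_Mapping.lookup m l"
    and nz: "Poly_Mapping.lookup (Poly_Mapping.lookup v (insert l \<tau>)) (m - Poly_Mapping.single l 1) \<noteq> 0"
    by (auto split: if_splits)
  have "mdeg m = Suc (mdeg (m - Poly_Mapping.single l 1))"
    using mdeg_add_single[of "m - Poly_Mapping.single l 1" l] diff_add_single[OF l(2)] by simp
  moreover have "card (insert l \<tau>) = Suc i \<and> mdeg (m - Poly_Mapping.single l 1) + Suc i = j"
    using v nz unfolding chains_koszul_iff by blast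
  ultimately show "card \<tau> = i \<and> mdeg m + i = j"
    using l(1) by simp
qed

lemma differential_koszul_differential: "differential koszul k (differential koszul l v) = 0"
proof (intro poly_mapping_eqI)
  fix \<tau> :: "'a set" and m :: "'a \<Rightarrow>\<^sub>0 nat"
  define g where "g a b = (if a \<notin> \<tau> \<and> b \<notin> \<tau> \<and> a \<noteq> b \<and> 0 < Poly_Mapping.lookup m a \<and> 0 < Poly_Mapping.lookup m b
    then koszul_sign a \<tau> * koszul_sign b (insert a \<tau>) *
      Poly_Mapping.lookup (Poly_Mapping.lookup v (insert b (insert a \<tau>)))
        (m - Poly_Mapping.single a 1 - Poly_Mapping.single b 1) else 0)" for a b
  have anti: "g b a = - g a b" if "a < b" for a b
  proof -
    have c: "m - Poly_Mapping.single a 1 - Poly_Mapping.single b 1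
        = m - Poly_Mapping.single b 1 - Poly_Mapping.single a (1::nat)"
      by (intro poly_mapping_eqI) (simp add: lookup_minus)
    have "koszul_sign a (insert b \<tau>) = (koszul_sign a \<tau> :: 'b)" if "b \<notin> \<tau>"
      using koszul_sign_insert_other[of b \<tau> a, where 'k = 'b] that \<open>a < b\<close> by auto
    moreover have "koszul_sign b (insert a \<tau>) = - (koszul_sign b \<tau> :: 'b)" if "a \<notin> \<tau>"
      using koszul_sign_insert_other[of a \<tau> b, where 'k = 'b] that \<open>a < b\<close> by auto
    ultimately show ?thesis
      using that unfolding g_def by (auto simp: c insert_commute[of b a] simp del: One_nat_def)
  qed
  have "Poly_Mapping.lookup (Poly_Mapping.lookup (differential koszul k (differential koszul l v)) \<tau>) m
      = (\<Sum>a\<in>UNIV. \<Sum>b\<in>UNIV. g a b)"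
    unfolding lookup_koszul_differential
    by (intro sum.cong refl)
      (auto simp: g_def sum_distrib_left lookup_minus lookup_single when_def mult.assoc intro!: sum.cong)
  also have "\<dots> = (\<Sum>a\<in>UNIV. \<Sum>b\<in>UNIV. (if a < b then g a b else 0) + (if b < a then g a b else 0))"
    by (intro sum.cong refl) (auto simp: g_def)
  also have "\<dots> = (\<Sum>a\<in>UNIV. \<Sum>b\<in>UNIV. if a < b then g a b else 0)
      + (\<Sum>a\<in>UNIV. \<Sum>b\<in>UNIV. if b < a then g a b else 0)"
    by (simp add: sum.distrib)
  also have "(\<Sum>a\<in>UNIV. \<Sum>b\<in>UNIV. if b < a then g a b else 0)
      = (\<Sum>b\<in>UNIV. \<Sum>a\<in>UNIV. if b < a then g a b else 0)"
    by (rule sum.swap)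
  also have "\<dots> = (\<Sum>b\<in>UNIV. \<Sum>a\<in>UNIV. - (if b < a then g b a else 0))"
    by (intro sum.cong refl) (auto simp: anti)
  finally show "Poly_Mapping.lookup (Poly_Mapping.lookup (differential koszul k (differential koszul l v)) \<tau>) m
      = Poly_Mapping.lookup (Poly_Mapping.lookup 0 \<tau>) m"
    by (simp add: sum_negf)
qed

text \<open>
  The contracting homotopy: in a multidegree other than \<open>0\<close> the Koszul complex is contracted by
  \<open>x\<^sup>m e\<^sub>\<sigma> \<mapsto> (x\<^sup>m / x\<^sub>t) (e\<^sub>t \<and> e\<^sub>\<sigma>)\<close>, with \<open>t\<close> the smallest variable of the multidegree.
\<close>
lemma koszul_contraction:
  fixes v :: "'n::{finite,linorder} set \<Rightarrow>\<^sub>0 ('n, 'k::field) mpoly"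
  assumes cyc: "differential koszul i v = 0" and v0: "Poly_Mapping.lookup (Poly_Mapping.lookup v {}) 0 = 0"
  shows "\<exists>w. differential koszul k w = v \<and>
    (\<forall>\<tau> m. Poly_Mapping.lookup (Poly_Mapping.lookup w \<tau>) m \<noteq> 0 \<longrightarrow>
      (\<exists>t\<in>\<tau>. Poly_Mapping.lookup (Poly_Mapping.lookup v (\<tau> - {t})) (m + Poly_Mapping.single t 1) \<noteq> 0))"
proof -
  let ?c = "\<lambda>v \<tau> m. Poly_Mapping.lookup (Poly_Mapping.lookup v \<tau>) m"
  let ?x = "\<lambda>l. Poly_Mapping.single l (1::nat)"
  define t where "t \<tau> m = Min (\<tau> \<union> Poly_Mapping.keys m)" for \<tau> :: "'n set" and m :: "'n \<Rightarrow>\<^sub>0 nat"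
  define h where "h \<tau> m = (if t \<tau> m \<in> \<tau> then ?c v (\<tau> - {t \<tau> m}) (m + ?x (t \<tau> m)) else 0)" for \<tau> m
  have fin: "finite {m. h \<tau> m \<noteq> 0}" for \<tau>
  proof (rule finite_subset)
    show "{m. h \<tau> m \<noteq> 0} \<subseteq> (\<Union>s\<in>\<tau>. (\<lambda>m. m - ?x s) ` Poly_Mapping.keys (Poly_Mapping.lookup v (\<tau> - {s})))"
    proof
      fix m assume "m \<in> {m. h \<tau> m \<noteq> 0}"
      then have "t \<tau> m \<in> \<tau>" "m + ?x (t \<tau> m) \<in> Poly_Mapping.keys (Poly_Mapping.lookup v (\<tau> - {t \<tau> m}))"
        by (auto simp: h_def in_keys_iff split: if_splits)
      then show "m \<in> (\<Union>s\<in>\<tau>. (\<lambda>m. m - ?x s) ` Poly_Mapping.keys (Poly_Mapping.lookup v (\<tau> - {s})))"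
        by (intro UN_I[of "t \<tau> m"] image_eqI[of _ _ "m + ?x (t \<tau> m)"]) simp_all
    qed
  qed simp
  define w where "w = Abs_poly_mapping (\<lambda>\<tau>. Abs_poly_mapping (h \<tau>))"
  have w: "?c w \<tau> m = h \<tau> m" for \<tau> m
    by (simp add: w_def fin)
  have "differential koszul k w = v"
  proof (intro poly_mapping_eqI)
    fix \<sigma> m
    show "?c (differential koszul k w) \<sigma> m = ?c v \<sigma> m"
    proof (cases "\<sigma> \<union> Poly_Mapping.keys m = {}")
      case True
      then have "\<sigma> = {}" "m = 0" by (auto intro!: poly_mapping_eqI simp: in_keys_iff)
      then show ?thesis using v0 by (simp add: lookup_koszul_differential)
    next
      case False
      define s where "s = t \<sigma> m"
      have s: "s \<in> \<sigma> \<union> Poly_Mapping.keys m" and s_le: "\<And>i. i \<in> \<sigma> \<union> Poly_Mapping.keys m \<Longrightarrow> s \<le> i"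
        using Min_in[OF _ False] unfolding s_def t_def by auto
      have t: "t (insert l \<sigma>) (m - ?x l) = s" if "0 < Poly_Mapping.lookup m l" for l
      proof -
        have "insert l \<sigma> \<union> Poly_Mapping.keys (m - ?x l) = \<sigma> \<union> Poly_Mapping.keys m"
          using that by (auto simp: in_keys_iff lookup_minus lookup_single when_def split: if_splits)
        then show ?thesis by (simp add: t_def s_def)
      qed
      have D: "?c (differential koszul k w) \<sigma> m =
        (\<Sum>l\<in>UNIV. if l \<notin> \<sigma> \<and> 0 < Poly_Mapping.lookup m l \<and> s \<in> insert l \<sigma> then
           koszul_sign l \<sigma> * ?c v (insert l \<sigma> - {s}) (m - ?x l + ?x s) else 0)"
        unfolding lookup_koszul_differential w h_def
        by (rule sum.cong[OF refl]) (auto simp: t simp del: One_nat_def)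
      show ?thesis
      proof (cases "s \<in> \<sigma>")
        case False
        with s have ms: "0 < Poly_Mapping.lookup m s" by (auto simp: in_keys_iff)
        have "?c (differential koszul k w) \<sigma> m =
          (\<Sum>l\<in>UNIV. if l = s then koszul_sign s \<sigma> * ?c v \<sigma> m else 0)"
          unfolding D using False ms diff_add_single[OF ms]
          by (intro sum.cong refl) auto
        also have "\<dots> = ?c v \<sigma> m"
          using koszul_sign_min[of \<sigma> s, where 'k = 'k] s_le by simp
        finally show ?thesis .
      next
        case True
        let ?\<sigma> = "\<sigma> - {s}" and ?m = "m + ?x s"
        have shift: "m - ?x l + ?x s = ?m - ?x l" if "0 < Poly_Mapping.lookup m l" for l
          using that by (intro poly_mapping_eqI)
            (auto simp: lookup_add lookup_minus lookup_single when_def)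
        have sgn: "koszul_sign l \<sigma> = - (koszul_sign l ?\<sigma> :: 'k)" if "0 < Poly_Mapping.lookup m l" "l \<notin> \<sigma>" for l
        proof -
          have "s \<le> l" using that s_le by (auto simp: in_keys_iff)
          with that True have "s < l" by (metis order_le_less)
          moreover have "insert s ?\<sigma> = \<sigma>" using True by auto
          ultimately show ?thesis using koszul_sign_insert_other[of s ?\<sigma> l, where 'k = 'k] by auto
        qed
        have "0 = ?c (differential koszul i v) ?\<sigma> ?m" by (simp add: cyc)
        also have "\<dots> = (\<Sum>l\<in>UNIV. (if l = s then ?c v \<sigma> m else 0)
            - (if l \<notin> \<sigma> \<and> 0 < Poly_Mapping.lookup m l then
                koszul_sign l \<sigma> * ?c v (insert l \<sigma> - {s}) (m - ?x l + ?x s) else 0))"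
          unfolding lookup_koszul_differential
        proof (intro sum.cong refl)
          fix l
          show "(if l \<notin> ?\<sigma> \<and> 0 < Poly_Mapping.lookup ?m l
              then koszul_sign l ?\<sigma> * ?c v (insert l ?\<sigma>) (?m - ?x l) else 0)
            = (if l = s then ?c v \<sigma> m else 0)
            - (if l \<notin> \<sigma> \<and> 0 < Poly_Mapping.lookup m l then
                koszul_sign l \<sigma> * ?c v (insert l \<sigma> - {s}) (m - ?x l + ?x s) else 0)"
          proof (cases "l = s")
            case eq: True
            have "koszul_sign s ?\<sigma> = (1::'k)" by (rule koszul_sign_min) (use s_le in auto)
            with True eq show ?thesis by (simp add: lookup_add insert_absorb)
          next
            case ne: False
            then have "insert l \<sigma> - {s} = insert l ?\<sigma>" by auto
            with ne sgn[of l] shift[of l] show ?thesis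
              by (auto simp: lookup_add lookup_single_not_eq)
          qed
        qed
        also have "\<dots> = ?c v \<sigma> m - ?c (differential koszul k w) \<sigma> m"
          unfolding sum_subtractf D using True by simp
        finally show ?thesis by simp
      qed
    qed
  qed
  moreover have "\<forall>\<tau> m. ?c w \<tau> m \<noteq> 0 \<longrightarrow> (\<exists>t\<in>\<tau>. ?c v (\<tau> - {t}) (m + ?x t) \<noteq> 0)"
    unfolding w h_def by auto
  ultimately show ?thesis by blast
qed

lemma koszul_exact:
  assumes v: "v \<in> chains koszul UNIV i j" and "differential koszul i v = 0"
    and "Poly_Mapping.lookup (Poly_Mapping.lookup v {}) 0 = 0"
  shows "v \<in> boundaries koszul UNIV i j"
proof -
  obtain w where w: "differential koszul (Suc i) w = v"
    "\<And>\<tau> m. Poly_Mapping.lookup (Poly_Mapping.lookup w \<tau>) m \<noteq> 0 \<Longrightarrow>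
      \<exists>t\<in>\<tau>. Poly_Mapping.lookup (Poly_Mapping.lookup v (\<tau> - {t})) (m + Poly_Mapping.single t 1) \<noteq> 0"
    using koszul_contraction[OF assms(2,3)] by metis
  have "w \<in> chains koszul UNIV (Suc i) j"
    unfolding chains_koszul_iff
  proof (intro allI impI)
    fix \<tau> m assume "Poly_Mapping.lookup (Poly_Mapping.lookup w \<tau>) m \<noteq> 0"
    with w(2) obtain t where "t \<in> \<tau>"
      "Poly_Mapping.lookup (Poly_Mapping.lookup v (\<tau> - {t})) (m + Poly_Mapping.single t 1) \<noteq> 0" by blast
    with v show "card \<tau> = Suc i \<and> mdeg m + Suc i = j"
      unfolding chains_koszul_iff using mdeg_add_single[of m t] card_Suc_Diff1[of \<tau> t]
      by fastforce
  qed
  with w(1) show ?thesis by (auto simp: boundaries_def)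
qed

theorem koszul_resolves_field:
  "resolves_field (koszul :: ('n::{finite,linorder} set, 'n, 'k::field) free_complex)"
  unfolding resolves_field_def
proof (intro conjI allI ballI)
  let ?K = "koszul :: ('n set, 'n, 'k) free_complex"
  have empty: "basis ?K 0 = {{}}" by (auto simp: koszul_def)
  show "finite (basis ?K i)" for i by simp
  show "bdry ?K (Suc i) b \<in> chains ?K UNIV i (bdeg ?K (Suc i) b)" if b: "b \<in> basis ?K (Suc i)" for i b
  proof -
    have "differential ?K (Suc i) (Poly_Mapping.single b 1) = bdry ?K (Suc i) b"
      by (auto intro!: poly_mapping_eqI simp: differential_def)
    moreover have "Poly_Mapping.single b 1 \<in> chains ?K UNIV (Suc i) (bdeg ?K (Suc i) b)"
      using b unfolding chains_koszul_iff
      by (auto simp: koszul_def lookup_single lookup_one when_def mdeg_def split: if_splits)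
    ultimately show ?thesis using differential_koszul_chains by metis
  qed
  show "cycles ?K UNIV (Suc i) j = boundaries ?K UNIV (Suc i) j" for i j
  proof (intro equalityI subsetI)
    fix v assume "v \<in> cycles ?K UNIV (Suc i) j"
    then have v: "v \<in> chains ?K UNIV (Suc i) j" "differential ?K (Suc i) v = 0"
      by (auto simp: cycles_def)
    moreover have "Poly_Mapping.lookup (Poly_Mapping.lookup v {}) 0 = 0"
      using v(1) unfolding chains_koszul_iff by fastforce
    ultimately show "v \<in> boundaries ?K UNIV (Suc i) j" by (rule koszul_exact)
  next
    fix v assume "v \<in> boundaries ?K UNIV (Suc i) j"
    then show "v \<in> cycles ?K UNIV (Suc i) j"
      by (auto simp: boundaries_def cycles_def differential_koszul_chains differential_koszul_differential)
  qed
  have "(\<Sum>b\<in>Poly_Mapping.keys v. 1 * Poly_Mapping.lookup (Poly_Mapping.lookup v b) 0)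
      = Poly_Mapping.lookup (Poly_Mapping.lookup v {}) 0" if "v \<in> chains ?K UNIV 0 j" for v j
  proof -
    have "Poly_Mapping.keys v \<subseteq> {{}}" using that empty by (auto simp: chains_def)
    then have "(\<Sum>b\<in>Poly_Mapping.keys v. Poly_Mapping.lookup (Poly_Mapping.lookup v b) 0)
        = (\<Sum>b\<in>{{}}. Poly_Mapping.lookup (Poly_Mapping.lookup v b) 0)"
      by (intro sum.mono_neutral_left) (auto simp: in_keys_iff)
    then show ?thesis by simp
  qed
  moreover have "differential ?K 0 v = 0" if "v \<in> chains ?K UNIV 0 j" for v j
  proof (intro poly_mapping_eqI)
    fix \<tau> m
    have "Poly_Mapping.lookup v (insert l \<tau>) = 0" for l
      using that empty by (auto simp: chains_def in_keys_iff)
    then show "Poly_Mapping.lookup (Poly_Mapping.lookup (differential ?K 0 v) \<tau>) m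
        = Poly_Mapping.lookup (Poly_Mapping.lookup 0 \<tau>) m"
      by (simp add: lookup_koszul_differential cong: if_cong)
  qed
  moreover have "Poly_Mapping.lookup (Poly_Mapping.lookup w {}) 0 = 0" "w \<in> chains ?K UNIV 0 j"
    if "w \<in> boundaries ?K UNIV 0 j" for w j
    using that by (auto simp: boundaries_def lookup_koszul_differential differential_koszul_chains)
  ultimately have "{v \<in> chains ?K UNIV 0 j.
      (\<Sum>b\<in>Poly_Mapping.keys v. 1 * Poly_Mapping.lookup (Poly_Mapping.lookup v b) 0) = 0}
      = boundaries ?K UNIV 0 j" for j
    using koszul_exact[where i = 0 and j = j and 'a = 'n and 'b = 'k]
    by (intro equalityI subsetI CollectI conjI) (metis (mono_tags, lifting) mem_Collect_eq)+
  moreover have "bdeg ?K 0 {} = 0" by (simp add: koszul_def)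
  ultimately show "\<exists>\<epsilon>. (\<exists>b\<in>basis ?K 0. \<epsilon> b \<noteq> 0) \<and> (\<forall>b\<in>basis ?K 0. \<epsilon> b \<noteq> 0 \<longrightarrow> bdeg ?K 0 b = 0) \<and>
      (\<forall>j. {v \<in> chains ?K UNIV 0 j.
         (\<Sum>b\<in>Poly_Mapping.keys v. \<epsilon> b * Poly_Mapping.lookup (Poly_Mapping.lookup v b) 0) = 0}
       = boundaries ?K UNIV 0 j)"
    unfolding empty by (intro exI[of _ "\<lambda>_. 1"]) simp
qed

end

theory Submission
  imports Defs
begin

text \<open>
  A monomial ideal is the span of the monomials with exponents in an upset \<open>U\<close>, and in multidegree \<open>b\<close> its
  Koszul complex is the chain complex of the simplicial complex of all \<open>\<tau>\<close> with \<open>x\<^sup>b / x\<^sup>\<tau> \<in> I\<close>.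

  Upper bound: if \<open>u / x\<^bsub>max u\<^esub> \<in> I\<close> for every monomial \<open>u \<in> I\<close> of degree above \<open>d\<close>, then for \<open>|b| > d + i\<close>
  the complex is in dimension \<open>i\<close> a cone with apex \<open>max b\<close>, so \<open>reg I \<le> d\<close>. This condition passes to
  intersections, and holds for every ideal that is primary to \<open>P = (x\<^sub>1, \<dots>, x\<^sub>k)\<close> and contains \<open>P\<^sup>d\<close>.

  Lower bound: if \<open>(x\<^sub>i\<^bsup>e i\<^esup> : i \<in> V)\<close> is an irreducible component of \<open>I\<close>, then some \<open>\<beta>\<^bsub>|V| - 1, b\<^esub>(I)\<close> with
  \<open>b = e\<close> on \<open>V\<close> does not vanish, so \<open>reg I\<close> is larger than the sum of the \<open>e i - 1\<close>.

  By Borel type every \<open>V\<close> is an initial segment of the variables. Hence each canonical component \<open>Q\<close>, with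
  radical \<open>P\<close>, contains \<open>P\<^bsup>reg I\<^esup>\<close>, its power \<open>Q\<^sup>q\<close> contains \<open>P\<^bsup>q reg I\<^esup>\<close>,
      and the upper bound applies.
\<close>

section \<open>Monomial ideals as upsets of exponents\<close>

abbreviation lookup :: "('a \<Rightarrow>\<^sub>0 'b::zero) \<Rightarrow> 'a \<Rightarrow> 'b" where
  "lookup \<equiv> Poly_Mapping.lookup"

abbreviation keys :: "('a \<Rightarrow>\<^sub>0 'b::zero) \<Rightarrow> 'a set" where
  "keys \<equiv> Poly_Mapping.keys"

abbreviation single :: "'a \<Rightarrow> 'b \<Rightarrow> ('a \<Rightarrow>\<^sub>0 'b::zero)" where
  "single \<equiv> Poly_Mapping.single"

definition divides :: "('n \<Rightarrow>\<^sub>0 nat) \<Rightarrow> ('n \<Rightarrow>\<^sub>0 nat) \<Rightarrow> bool"  (infix "\<preceq>" 50) where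
  "u \<preceq> m \<longleftrightarrow> (\<forall>i. lookup u i \<le> lookup m i)"

lemma divides_refl [simp]: "u \<preceq> u"
  by (simp add: divides_def)

lemma divides_trans: "u \<preceq> v \<Longrightarrow> v \<preceq> w \<Longrightarrow> u \<preceq> w"
  unfolding divides_def by (meson order_trans)

lemma divides_add [simp]: "u \<preceq> u + v" "v \<preceq> u + v"
  by (simp_all add: divides_def lookup_add)

lemma divides_minus: "m - u \<preceq> m"
  by (simp add: divides_def lookup_minus)

lemma dividesD: "u \<preceq> m \<Longrightarrow> m = u + (m - u)"
  by (intro poly_mapping_eqI) (simp add: divides_def lookup_add lookup_minus)

definition upset :: "('n \<Rightarrow>\<^sub>0 nat) set \<Rightarrow> bool" where
  "upset U \<longleftrightarrow> (\<forall>u\<in>U. \<forall>m. u \<preceq> m \<longrightarrow> m \<in> U)"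

lemma upsetD: "upset U \<Longrightarrow> u \<in> U \<Longrightarrow> u \<preceq> m \<Longrightarrow> m \<in> U"
  by (auto simp: upset_def)

lemma upset_UNIV [simp]: "upset UNIV"
  by (simp add: upset_def)

lemma upset_Inter: "(\<And>U. U \<in> \<U> \<Longrightarrow> upset U) \<Longrightarrow> upset (\<Inter>\<U>)"
  unfolding upset_def by blast

text \<open>In general only a \<open>K\<close>-subspace; it is an ideal once \<open>U\<close> is an
  upset.\<close>

definition monomial_span :: "('n \<Rightarrow>\<^sub>0 nat) set \<Rightarrow> ('n, 'k::field) mpoly set" where
  "monomial_span U = {f. keys f \<subseteq> U}"

lemma zero_in_monomial_span [simp]: "0 \<in> monomial_span U"
  by (simp add: monomial_span_def)

lemma keys_monomial [simp]: "keys (monomial m :: ('n, 'k::field) mpoly) = {m}"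
  by (simp add: monomial_def)

lemma monomial_in_monomial_span [simp]: "monomial m \<in> monomial_span U \<longleftrightarrow> m \<in> U"
  by (simp add: monomial_span_def)

lemma monomial_span_UNIV: "monomial_span UNIV = UNIV"
  by (simp add: monomial_span_def)

lemma monomial_span_subset_iff:
  "(monomial_span U :: ('n, 'k::field) mpoly set) \<subseteq> monomial_span W \<longleftrightarrow> U \<subseteq> W"
proof
  assume *: "(monomial_span U :: ('n, 'k) mpoly set) \<subseteq> monomial_span W"
  show "U \<subseteq> W"
  proof
    fix m assume "m \<in> U"
    then have "(monomial m :: ('n, 'k) mpoly) \<in> monomial_span U" by simp
    with * have "(monomial m :: ('n, 'k) mpoly) \<in> monomial_span W" by blast
    then show "m \<in> W" by simp
  qed
qed (auto simp: monomial_span_def)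

lemma monomial_span_eq_iff: "(monomial_span U :: ('n, 'k::field) mpoly set) = monomial_span W \<longleftrightarrow> U = W"
  using monomial_span_subset_iff[where 'k = 'k] by (metis subset_antisym subset_refl)

lemma monomial_span_Inter: "monomial_span (\<Inter>\<U>) = (\<Inter>U\<in>\<U>. monomial_span U)"
  by (auto simp: monomial_span_def)

lemma monomial_mult: "monomial a * monomial b = monomial (a + b)"
  by (simp add: monomial_def mult_single)

lemma monomial_zero: "monomial 0 = 1"
  by (simp add: monomial_def)

lemma var_power: "var i ^ k = monomial (single i k)"
proof (induction k)
  case (Suc k)
  then show ?case
    by (simp add: var_def monomial_mult flip: single_add)
qed (simp add: monomial_zero)

lemma single_lookup_sum: "f = (\<Sum>m\<in>keys f. single m (lookup f m))"
  by (intro poly_mapping_eqI)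
     (simp add: lookup_sum lookup_single when_def in_keys_iff)

lemma monomial_span_closed:
  assumes "upset U"
  shows "f \<in> monomial_span U \<Longrightarrow> g \<in> monomial_span U \<Longrightarrow> f + g \<in> monomial_span U"
    and "g \<in> monomial_span U \<Longrightarrow> f * g \<in> monomial_span U"
proof -
  show "f \<in> monomial_span U \<Longrightarrow> g \<in> monomial_span U \<Longrightarrow> f + g \<in> monomial_span U"
    using keys_add[of f g] by (auto simp: monomial_span_def)
  show "g \<in> monomial_span U \<Longrightarrow> f * g \<in> monomial_span U"
    using keys_mult[of f g] upsetD[OF assms _ divides_add(2)] unfolding monomial_span_def by blast
qed

lemma ideal_gen_monomials:
  "ideal_gen (monomial ` A) = (monomial_span {m. \<exists>a\<in>A. a \<preceq> m} :: ('n, 'k::field) mpoly set)"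
proof -
  interpret ring_module: module "(*) :: ('n, 'k) mpoly \<Rightarrow> ('n, 'k) mpoly \<Rightarrow> ('n, 'k) mpoly"
    by (rule module_mult)
  let ?U = "{m. \<exists>a\<in>A. a \<preceq> m}"
  have up: "upset ?U" by (auto simp: upset_def intro: divides_trans)
  show ?thesis
    unfolding ideal_gen_def
  proof (intro equalityI subsetI)
    fix f :: "('n, 'k) mpoly" assume f: "f \<in> ring_module.span (monomial ` A)"
    have "ring_module.span (monomial ` A) \<subseteq> (monomial_span ?U :: ('n, 'k) mpoly set)"
    proof (rule ring_module.span_minimal)
      show "monomial ` A \<subseteq> (monomial_span ?U :: ('n, 'k) mpoly set)"
        using divides_refl by force
      show "ring_module.subspace (monomial_span ?U)"
        by (intro ring_module.subspaceI zero_in_monomial_span monomial_span_closed[OF up])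
    qed
    with f show "f \<in> monomial_span ?U" by blast
  next
    fix f :: "('n, 'k) mpoly" assume f: "f \<in> monomial_span ?U"
    have "(\<Sum>m\<in>keys f. single m (lookup f m)) \<in> ring_module.span (monomial ` A)"
    proof (rule ring_module.span_sum)
      fix m assume "m \<in> keys f"
      with f obtain a where a: "a \<in> A" "a \<preceq> m" by (auto simp: monomial_span_def)
      have "single m (lookup f m) = single (m - a) (lookup f m) * monomial a"
        using dividesD[OF a(2)] by (simp add: monomial_def mult_single add.commute)
      with a(1) show "single m (lookup f m) \<in> ring_module.span (monomial ` A)"
        by (auto intro: ring_module.span_scale ring_module.span_base)
    qed
    then show "f \<in> ring_module.span (monomial ` A)" by (simp flip: single_lookup_sum)
  qed
qed

lemma ideal_gen_monomials_upset:
  assumes "upset U" shows "ideal_gen (monomial ` U) = (monomial_span U :: ('n, 'k::field) mpoly set)"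
proof -
  have "{m. \<exists>a\<in>U. a \<preceq> m} = U" using upsetD[OF assms] by (auto intro: divides_refl)
  then show ?thesis by (simp add: ideal_gen_monomials)
qed

lemma monomial_idealE:
  assumes "monomial_ideal I"
  obtains U where "upset U" "I = monomial_span U"
proof -
  obtain A where "I = monomial_span {m. \<exists>a\<in>A. a \<preceq> m}"
    using assms by (auto simp: monomial_ideal_def ideal_gen_monomials)
  moreover have "upset {m. \<exists>a\<in>A. a \<preceq> m}"
    by (auto simp: upset_def intro: divides_trans)
  ultimately show ?thesis using that by blast
qed

section \<open>Products and powers in terms of exponents\<close>

definition sumset :: "('n \<Rightarrow>\<^sub>0 nat) set \<Rightarrow> ('n \<Rightarrow>\<^sub>0 nat) set \<Rightarrow> ('n \<Rightarrow>\<^sub>0 nat) set" where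
  "sumset U W = {u + w | u w. u \<in> U \<and> w \<in> W}"

text \<open>The value \<open>UNIV\<close> at 0 is the exponent set of the unit ideal, as in
  \<open>ideal_power\<close>. For an upset \<open>U\<close> the first power
  \<open>sumset U UNIV\<close> is \<open>U\<close> again.\<close>

fun sumset_power :: "('n \<Rightarrow>\<^sub>0 nat) set \<Rightarrow> nat \<Rightarrow> ('n \<Rightarrow>\<^sub>0 nat) set" where
  "sumset_power U 0 = UNIV"
| "sumset_power U (Suc k) = sumset U (sumset_power U k)"

text \<open>The second summand absorbs the whole surplus: if \<open>u + w \<preceq> m\<close>, then
  \<open>m - u\<close> lies above \<open>w\<close>.\<close>

lemma upset_sumset:
  assumes "upset W" shows "upset (sumset U W)"
  unfolding upset_def
proof (intro ballI allI impI)
  fix v m assume "v \<in> sumset U W" "v \<preceq> m"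
  then obtain u w where uw: "v = u + w" "u \<in> U" "w \<in> W" by (auto simp: sumset_def)
  have "w \<preceq> m - u"
    using \<open>v \<preceq> m\<close> by (auto simp: divides_def uw(1) lookup_add lookup_minus add_le_imp_le_diff add.commute)
  then have "m - u \<in> W" by (rule upsetD[OF assms uw(3)])
  moreover have "u \<preceq> m" using \<open>v \<preceq> m\<close> uw(1) divides_trans divides_add(1) by blast
  ultimately show "m \<in> sumset U W"
    using dividesD uw(2) unfolding sumset_def by blast
qed

lemma upset_sumset_power: "upset (sumset_power U k)"
  by (induction k) (simp_all add: upset_sumset)

lemma ideal_mult_monomial_span:
  assumes "upset W"
  shows "ideal_mult (monomial_span U) (monomial_span W) = (monomial_span (sumset U W) :: ('n, 'k::field) mpoly set)"
proof -
  interpret ring_module: module "(*) :: ('n, 'k) mpoly \<Rightarrow> ('n, 'k) mpoly \<Rightarrow> ('n, 'k) mpoly"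
    by (rule module_mult)
  let ?P = "{f * g | f g. f \<in> monomial_span U \<and> g \<in> monomial_span W} :: ('n, 'k) mpoly set"
  note up = upset_sumset[OF assms, of U]
  have "ring_module.span ?P \<subseteq> monomial_span (sumset U W)"
  proof (rule ring_module.span_minimal)
    show "?P \<subseteq> monomial_span (sumset U W)"
    proof safe
      fix f g :: "('n, 'k) mpoly" assume "f \<in> monomial_span U" "g \<in> monomial_span W"
      then show "f * g \<in> monomial_span (sumset U W)"
        using keys_mult[of f g] unfolding monomial_span_def sumset_def by blast
    qed
    show "ring_module.subspace (monomial_span (sumset U W))"
      by (intro ring_module.subspaceI zero_in_monomial_span monomial_span_closed[OF up])
  qed
  moreover have "monomial ` sumset U W \<subseteq> ?P"
  proof safe
    fix m assume "m \<in> sumset U W"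
    then obtain u w where "m = u + w" "u \<in> U" "w \<in> W" by (auto simp: sumset_def)
    then have "monomial m = monomial u * (monomial w :: ('n, 'k) mpoly)"
      "monomial u \<in> (monomial_span U :: ('n, 'k) mpoly set)" "monomial w \<in> (monomial_span W :: ('n, 'k) mpoly set)"
      by (simp_all add: monomial_mult)
    then show "\<exists>f g. (monomial m :: ('n, 'k) mpoly) = f * g \<and> f \<in> monomial_span U \<and>
        g \<in> monomial_span W"
      by blast
  qed
  then have "ring_module.span (monomial ` sumset U W) \<subseteq> ring_module.span ?P"
    by (rule ring_module.span_mono)
  ultimately show ?thesis
    using ideal_gen_monomials_upset[OF up, where 'k = 'k]
    unfolding ideal_mult_def ideal_gen_def by blast
qed

lemma ideal_power_monomial_span: "ideal_power (monomial_span U) k = monomial_span (sumset_power U k)"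
  by (induction k) (simp_all add: monomial_span_UNIV ideal_mult_monomial_span upset_sumset_power)

section \<open>Irreducible monomial ideals as exponent sets\<close>

definition irreducible_upset :: "'n set \<Rightarrow> ('n \<Rightarrow> nat) \<Rightarrow> ('n \<Rightarrow>\<^sub>0 nat) set" where
  "irreducible_upset V e = {m. \<exists>i\<in>V. e i \<le> lookup m i}"

lemma irreducible_upset_iff: "m \<in> irreducible_upset V e \<longleftrightarrow> (\<exists>i\<in>V. e i \<le> lookup m i)"
  by (simp add: irreducible_upset_def)

lemma upset_irreducible_upset: "upset (irreducible_upset V e)"
  unfolding upset_def divides_def by (meson irreducible_upset_iff order_trans)

lemma ideal_gen_var_powers:
  "ideal_gen ((\<lambda>i. var i ^ e i) ` V) = (monomial_span (irreducible_upset V e) :: ('n, 'k::field) mpoly set)"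
proof -
  have "(\<lambda>i. var i ^ e i) ` V = (monomial ` (\<lambda>i. single i (e i)) ` V :: ('n, 'k) mpoly set)"
    by (simp add: var_power image_image)
  moreover have "single i k \<preceq> m \<longleftrightarrow> k \<le> lookup m i" for i :: 'n and k m
    by (auto simp: divides_def lookup_single when_def)
  ultimately show ?thesis
    by (simp add: ideal_gen_monomials irreducible_upset_def)
qed

lemma irreducible_monomial_ideal_iff:
  "irreducible_monomial_ideal C \<longleftrightarrow>
     (\<exists>V e. (\<forall>i\<in>V. 0 < e i) \<and> C = monomial_span (irreducible_upset V e))"
  by (simp add: irreducible_monomial_ideal_def ideal_gen_var_powers)

lemma ideal_gen_vars: "ideal_gen (var ` V) = monomial_span (irreducible_upset V (\<lambda>_. 1))"
  using ideal_gen_var_powers[of "\<lambda>_. 1" V] by simp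

section \<open>Irreducible components\<close>

text \<open>Finiteness of the decomposition, by induction on the set \<open>T\<close> of free
  coordinates: \<open>a\<close> fixes the coordinates outside \<open>T\<close>, and only the
  exponents in this slice have to be separated from \<open>U\<close>.\<close>

lemma downset_covered_by_boxes:
  fixes U :: "('n::finite \<Rightarrow>\<^sub>0 nat) set" and T :: "'n set"
  assumes "upset U"
  shows "\<exists>\<W>. finite \<W> \<and>
    (\<forall>W\<in>\<W>. U \<subseteq> W \<and> (\<exists>V e. (\<forall>i\<in>V. 0 < e i) \<and> W = irreducible_upset V e)) \<and>
    (\<forall>m. m \<notin> U \<longrightarrow> (\<forall>i. i \<notin> T \<longrightarrow> lookup m i = a i) \<longrightarrow> m \<notin> \<Inter>\<W>)"
  using finite[of T]
proof (induction T arbitrary: a rule: finite_psubset_induct)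
  case (psubset T)
  let ?good = "\<lambda>W. U \<subseteq> W \<and> (\<exists>V e. (\<forall>i\<in>V. 0 < e i) \<and> W = irreducible_upset V e)"
  let ?slice = "\<lambda>T a m. \<forall>i. i \<notin> T \<longrightarrow> lookup m i = (a i :: nat)"
  show ?case
  proof (cases "\<exists>g\<in>U. ?slice T a g")
    case False
    \<comment> \<open>If the slice misses \<open>U\<close>, a single irreducible upset contains
      \<open>U\<close> and misses the whole slice.\<close>
    let ?W = "irreducible_upset (- T) (\<lambda>i. Suc (a i))"
    have "U \<subseteq> ?W"
    proof (rule ccontr)
      assume "\<not> U \<subseteq> ?W"
      then obtain m where "m \<in> U" "m \<notin> ?W" by blast
      then have m: "m \<in> U" "\<And>i. i \<notin> T \<Longrightarrow> lookup m i \<le> a i"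
        by (auto simp: irreducible_upset_iff not_less_eq_eq)
      \<comment> \<open>Raising the coordinates outside \<open>T\<close> to the values of
        \<open>a\<close> moves \<open>m\<close> into the slice without leaving
        \<open>U\<close>.\<close>
      define m' where "m' = Abs_poly_mapping (\<lambda>i. if i \<in> T then lookup m i else a i)"
      have m': "lookup m' i = (if i \<in> T then lookup m i else a i)" for i
        by (simp add: m'_def)
      have "m' \<in> U" using m by (auto intro!: upsetD[OF assms m(1)] simp: divides_def m')
      with False m' show False by auto
    qed
    then show ?thesis
      by (intro exI[of _ "{?W}"]) (auto simp: irreducible_upset_iff)
  next
    case True
    then obtain g where g: "g \<in> U" "?slice T a g" by blast
    define P where "P i c \<W> \<longleftrightarrow> finite \<W> \<and> (\<forall>W\<in>\<W>. ?good W) \<and>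
        (\<forall>m. m \<notin> U \<longrightarrow> ?slice (T - {i}) (a(i := c)) m \<longrightarrow> m \<notin> \<Inter>\<W>)" for i c \<W>
    define f where "f i c = (SOME \<W>. P i c \<W>)" for i c
    have f: "P i c (f i c)" if "i \<in> T" for i c
    proof -
      have "T - {i} \<subset> T" using that by blast
      from psubset.IH[OF this, of "a(i := c)"] have "\<exists>\<W>. P i c \<W>" unfolding P_def .
      then show ?thesis unfolding f_def by (rule someI_ex)
    qed
    \<comment> \<open>An exponent of the slice outside \<open>U\<close> is not above
      \<open>g\<close>, so some coordinate \<open>i\<close> in \<open>T\<close> has a value
      \<open>c < lookup g i\<close>. The finitely many slices that fix this further coordinate are
      covered by induction.\<close>
    let ?F = "\<Union>i\<in>T. \<Union>c<lookup g i. f i c"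
    show ?thesis
    proof (intro exI[of _ ?F] conjI)
      have "finite (f i c)" if "i \<in> T" for i c using f[OF that] unfolding P_def by blast
      then show "finite ?F" using psubset.hyps by (intro finite_UN_I) simp_all
      show "\<forall>W\<in>?F. ?good W" using f unfolding P_def by blast
      show "\<forall>m. m \<notin> U \<longrightarrow> ?slice T a m \<longrightarrow> m \<notin> \<Inter>?F"
      proof (intro allI impI)
        fix m assume m: "m \<notin> U" "?slice T a m"
        then have "\<not> g \<preceq> m" using upsetD[OF assms g(1)] by blast
        then obtain i where i: "lookup m i < lookup g i" by (auto simp: divides_def not_le)
        then have "i \<in> T" using m(2) g(2) by (metis less_irrefl)
        have "?slice (T - {i}) (a(i := lookup m i)) m" using m(2) by simp
        with f[OF \<open>i \<in> T\<close>, of "lookup m i"] m(1) have "m \<notin> \<Inter>(f i (lookup m i))"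
          unfolding P_def by blast
        with \<open>i \<in> T\<close> i show "m \<notin> \<Inter>?F" by blast
      qed
    qed
  qed
qed

lemma irreducible_decomposition_exists:
  fixes I :: "('n::finite, 'k::field) mpoly set"
  assumes "monomial_ideal I"
  shows "\<exists>\<C>. finite \<C> \<and> (\<forall>C\<in>\<C>. irreducible_monomial_ideal C) \<and> \<Inter>\<C> = I"
proof -
  obtain U where U: "upset U" "I = monomial_span U" using assms by (rule monomial_idealE)
  have "\<exists>\<W>. finite \<W> \<and>
      (\<forall>W\<in>\<W>. U \<subseteq> W \<and> (\<exists>V e. (\<forall>i\<in>V. 0 < e i) \<and> W = irreducible_upset V e)) \<and>
      (\<forall>m. m \<notin> U \<longrightarrow> m \<notin> \<Inter>\<W>)"
    using downset_covered_by_boxes[OF U(1), of UNIV] by simp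
  then obtain \<W> where \<W>: "finite \<W>"
      "\<forall>W\<in>\<W>. U \<subseteq> W \<and> (\<exists>V e. (\<forall>i\<in>V. 0 < e i) \<and> W = irreducible_upset V e)"
      "\<forall>m. m \<notin> U \<longrightarrow> m \<notin> \<Inter>\<W>"
    by (elim exE conjE)
  then have "\<Inter>\<W> = U" by (intro equalityI) blast+
  then have "\<Inter>(monomial_span ` \<W>) = I" by (simp only: U(2) flip: monomial_span_Inter)
  moreover have "\<forall>C\<in>monomial_span ` \<W>. irreducible_monomial_ideal (C :: ('n, 'k) mpoly set)"
  proof
    fix C :: "('n, 'k) mpoly set" assume "C \<in> monomial_span ` \<W>"
    then obtain W where W: "W \<in> \<W>" "C = monomial_span W" by (elim imageE)
    obtain V e where "\<forall>i\<in>V. 0 < e i" "W = irreducible_upset V e"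
      using \<W>(2)[rule_format, OF W(1)] by (elim exE conjE)
    with W(2) show "irreducible_monomial_ideal C"
      unfolding irreducible_monomial_ideal_iff by (intro exI[of _ V] exI[of _ e]) simp
  qed
  ultimately show ?thesis using \<W>(1) by (intro exI[of _ "monomial_span ` \<W>"] conjI finite_imageI)
qed

lemma irredundant_decomposition_exists:
  fixes I :: "('n::finite, 'k::field) mpoly set"
  assumes "monomial_ideal I"
  shows "\<exists>\<C>. irredundant_decomposition I \<C>"
proof -
  let ?D = "\<lambda>\<C>. finite \<C> \<and> (\<forall>C\<in>\<C>. irreducible_monomial_ideal C) \<and> \<Inter>\<C> = I"
  obtain \<C>\<^sub>0 where "?D \<C>\<^sub>0" using irreducible_decomposition_exists[OF assms] by (elim exE)
  \<comment> \<open>A decomposition with the fewest components is irredundant, since dropping a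
    component would give a smaller one.\<close>
  define \<C> where "\<C> = arg_min card ?D"
  have \<C>: "?D \<C>" and min: "\<forall>\<D>. ?D \<D> \<longrightarrow> card \<C> \<le> card \<D>"
    using arg_min_nat_lemma[of ?D, OF \<open>?D \<C>\<^sub>0\<close>, of card] unfolding \<C>_def by simp_all
  have "\<Inter>(\<C> - {C}) \<noteq> I" if "C \<in> \<C>" for C
    using min[rule_format, of "\<C> - {C}"] \<C> that card_Diff1_less[of \<C> C] by force
  with \<C> show ?thesis unfolding irredundant_decomposition_def by (intro exI[of _ \<C>]) simp
qed

text \<open>The complement of an irreducible upset is closed under least common multiples.\<close>

lemma irreducible_contains_factor:
  fixes \<C> :: "('n::finite, 'k::field) mpoly set set"
  assumes "finite \<C>" "\<And>C. C \<in> \<C> \<Longrightarrow> irreducible_monomial_ideal C"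
    and "irreducible_monomial_ideal D" "\<Inter>\<C> \<subseteq> D"
  shows "\<exists>C\<in>\<C>. C \<subseteq> D"
proof (rule ccontr)
  assume neg: "\<not> ?thesis"
  obtain V e where D: "D = monomial_span (irreducible_upset V e)" and e: "\<forall>i\<in>V. 0 < e i"
    using assms(3) by (auto simp: irreducible_monomial_ideal_iff)
  have "\<exists>m. monomial m \<in> C \<and> m \<notin> irreducible_upset V e" if "C \<in> \<C>" for C
  proof -
    obtain W where "C = monomial_span W"
      using assms(2)[OF \<open>C \<in> \<C>\<close>] by (auto simp: irreducible_monomial_ideal_iff)
    with neg that D show ?thesis
        using monomial_span_subset_iff[of W "irreducible_upset V e", where 'k = 'k] by auto
  qed
  then obtain m where m: "\<And>C. C \<in> \<C> \<Longrightarrow> monomial (m C) \<in> C \<and> m C \<notin> irreducible_upset V e"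
    by metis
  \<comment> \<open>The least common multiple of the witnesses. The inserted 0 keeps
    \<open>Max\<close> defined for the empty family, whose intersection is the whole ring.\<close>
  define s where "s = Abs_poly_mapping (\<lambda>i. Max (insert 0 ((\<lambda>C. lookup (m C) i) ` \<C>)))"
  have s: "lookup s i = Max (insert 0 ((\<lambda>C. lookup (m C) i) ` \<C>))" for i
    by (simp add: s_def)
  have "monomial s \<in> C" if C: "C \<in> \<C>" for C
  proof -
    obtain V' e' where W: "C = monomial_span (irreducible_upset V' e')"
      using assms(2)[OF C] by (auto simp: irreducible_monomial_ideal_iff)
    have "m C \<preceq> s" using C assms(1) by (auto simp: divides_def s)
    moreover have "m C \<in> irreducible_upset V' e'" using m[OF C] W by simp
    ultimately have "s \<in> irreducible_upset V' e'"
      using upsetD[OF upset_irreducible_upset] by blast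
    then show ?thesis by (simp add: W)
  qed
  then have "monomial s \<in> D" using assms(4) by blast
  then obtain i where i: "i \<in> V" "e i \<le> lookup s i"
    by (auto simp: D irreducible_upset_iff)
  \<comment> \<open>The maximum is attained, so this exponent is 0 or comes from some
    \<open>m C\<close>; either way it is below \<open>e i\<close>.\<close>
  have "lookup s i \<in> insert 0 ((\<lambda>C. lookup (m C) i) ` \<C>)"
    unfolding s using assms(1) by (intro Max_in) auto
  then show False
    using i e m by (fastforce simp: irreducible_upset_iff)
qed

lemma irredundant_decomposition_incomparable:
  assumes "irredundant_decomposition I \<C>" "C \<in> \<C>" "D \<in> \<C>" "C \<subseteq> D"
  shows "C = D"
proof (rule ccontr)
  assume "C \<noteq> D"
  then have "\<Inter>(\<C> - {D}) = \<Inter>\<C>" using assms(2-4) by blast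
  then show False using assms by (auto simp: irredundant_decomposition_def)
qed

text \<open>A component contains a member of the other decomposition, which in turn contains a
  component of the first. Incomparability makes the two ends of this chain equal.\<close>

lemma irredundant_decomposition_subset:
  fixes I :: "('n::finite, 'k::field) mpoly set"
  assumes "irredundant_decomposition I \<C>" "irredundant_decomposition I \<D>"
  shows "\<C> \<subseteq> \<D>"
proof
  fix C assume C: "C \<in> \<C>"
  have factor: "\<exists>E\<in>\<E>. E \<subseteq> D"
    if "irredundant_decomposition I \<D>" "irredundant_decomposition I \<E>" "D \<in> \<D>" for D \<D> \<E>
    using that unfolding irredundant_decomposition_def
    by (intro irreducible_contains_factor) auto
  obtain D where D: "D \<in> \<D>" "D \<subseteq> C"
    using factor[OF assms C] by (elim bexE)
  obtain C' where C': "C' \<in> \<C>" "C' \<subseteq> D"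
    using factor[OF assms(2,1) D(1)] by (elim bexE)
  have "C' = C"
    using irredundant_decomposition_incomparable[OF assms(1) C'(1) C] C' D by simp
  with C' D show "C \<in> \<D>" by simp
qed

lemma irredundant_decomposition_irreducible_components:
  fixes I :: "('n::finite, 'k::field) mpoly set"
  assumes "monomial_ideal I"
  shows "irredundant_decomposition I (irreducible_components I)"
proof -
  obtain \<C> where "irredundant_decomposition I \<C>"
    using irredundant_decomposition_exists[OF assms] by blast
  then show ?thesis
    unfolding irreducible_components_def
    by (rule theI) (meson irredundant_decomposition_subset subset_antisym \<open>irredundant_decomposition I \<C>\<close>)
qed

text \<open>The canonical presentation groups components by radical; this recovers the variable set
  of a component from its radical.\<close>

lemma var_in_radical_iff:
  assumes "\<forall>i\<in>V. 0 < e i"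
  shows "var i \<in> radical (monomial_span (irreducible_upset V e) :: ('n, 'k::field) mpoly set) \<longleftrightarrow> i \<in> V"
proof
  assume "var i \<in> radical (monomial_span (irreducible_upset V e) :: ('n, 'k) mpoly set)"
  then obtain k l where "l \<in> V" "e l \<le> lookup (single i k) l"
    by (auto simp: radical_def var_power irreducible_upset_iff)
  then show "i \<in> V" using assms by (auto simp: lookup_single when_def split: if_splits)
next
  assume "i \<in> V"
  then have "(var i ^ e i :: ('n, 'k) mpoly) \<in> monomial_span (irreducible_upset V e)"
    by (auto simp: var_power irreducible_upset_iff intro!: bexI[of _ i])
  then show "var i \<in> radical (monomial_span (irreducible_upset V e) :: ('n, 'k) mpoly set)"
    unfolding radical_def by blast
qed

text \<open>Irredundancy in the form of a witness: \<open>w\<close> is a monomial of all other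
  components outside \<open>C\<close>, so a multiple of \<open>w\<close> lies in \<open>I\<close> as
  soon as it lies in \<open>C\<close>.\<close>

lemma irreducible_componentE:
  fixes I :: "('n::finite, 'k::field) mpoly set"
  assumes "monomial_ideal I" "C \<in> irreducible_components I"
  obtains V e w where "C = monomial_span (irreducible_upset V e)" "\<forall>i\<in>V. 0 < e i"
    "w \<notin> irreducible_upset V e"
    "\<And>m. w \<preceq> m \<Longrightarrow> m \<in> irreducible_upset V e \<Longrightarrow> monomial m \<in> I"
    "\<And>m. m \<notin> irreducible_upset V e \<Longrightarrow> monomial m \<notin> I"
proof -
  let ?\<C> = "irreducible_components I"
  have dec: "\<And>C. C \<in> ?\<C> \<Longrightarrow> irreducible_monomial_ideal C" "\<Inter>?\<C> = I" "\<Inter>(?\<C> - {C}) \<noteq> I"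
    using irredundant_decomposition_irreducible_components[OF assms(1)] assms(2)
    by (auto simp: irredundant_decomposition_def)
  obtain V e where C: "C = monomial_span (irreducible_upset V e)" "\<forall>i\<in>V. 0 < e i"
    using dec(1)[OF assms(2)] by (auto simp: irreducible_monomial_ideal_iff)
  have "\<exists>U. D = monomial_span U \<and> upset U" if "D \<in> ?\<C>" for D
    using dec(1)[OF that] upset_irreducible_upset unfolding irreducible_monomial_ideal_iff by blast
  then obtain U where U: "\<And>D. D \<in> ?\<C> \<Longrightarrow> D = monomial_span (U D) \<and> upset (U D)"
    by metis
  let ?U = "\<Inter>(U ` (?\<C> - {C}))"
  have rest: "\<Inter>(?\<C> - {C}) = monomial_span ?U"
    unfolding monomial_span_Inter using U by auto
  have I: "I = monomial_span ?U \<inter> C" using dec(2) assms(2) rest by blast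
  have I': "monomial m \<in> I \<longleftrightarrow> m \<in> ?U \<and> m \<in> irreducible_upset V e" for m
    by (subst I) (simp only: Int_iff monomial_in_monomial_span C(1))
  from I rest dec(3) have "\<not> (monomial_span ?U :: ('n, 'k) mpoly set) \<subseteq> C" by blast
  then obtain w where w: "w \<in> ?U" "w \<notin> irreducible_upset V e"
    using monomial_span_subset_iff[where 'k = 'k, of ?U] C(1) by blast
  have "upset ?U" by (rule upset_Inter) (use U in auto)
  then have "monomial m \<in> I" if "w \<preceq> m" "m \<in> irreducible_upset V e" for m
    using upsetD[OF _ w(1) that(1)] that(2) I' by simp
  moreover have "monomial m \<notin> I" if "m \<notin> irreducible_upset V e" for m
    using that I' by simp
  ultimately show ?thesis using C w(2) by (intro that)
qed

text \<open>
  If \<open>j \<in> V\<close> and \<open>i < j\<close>, a monomial outside the component that lies in all others is moved into the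
  ideal by a power of \<open>x\<^sub>j\<close>, hence by Borel type by a power of \<open>x\<^sub>i\<close>, which forces \<open>i \<in> V\<close>.
\<close>

lemma borel_type_component_variables:
  fixes I :: "('n::{finite,linorder}, 'k::field) mpoly set"
  assumes "borel_type I" and C: "monomial_span (irreducible_upset V e) \<in> irreducible_components I"
    and e: "\<forall>i\<in>V. 0 < e i" and "j \<in> V" "i \<le> j"
  shows "i \<in> V"
proof (rule ccontr)
  assume "i \<notin> V"
  have mon: "monomial_ideal I" using assms(1) by (simp add: borel_type_def)
  obtain V' e' w where "monomial_span (irreducible_upset V e) = (monomial_span (irreducible_upset V' e') :: ('n, 'k) mpoly set)"
    and w': "w \<notin> irreducible_upset V' e'"
      "\<And>m. w \<preceq> m \<Longrightarrow> m \<in> irreducible_upset V' e' \<Longrightarrow> monomial m \<in> I"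
      "\<And>m. m \<notin> irreducible_upset V' e' \<Longrightarrow> monomial m \<notin> I"
    using irreducible_componentE[OF mon C] by metis
  then have eq: "irreducible_upset V' e' = irreducible_upset V e"
      by (simp add: monomial_span_eq_iff)
  note w = w'[unfolded eq]
  obtain U where U: "upset U" "I = monomial_span U" using mon by (rule monomial_idealE)
  let ?X = "\<lambda>V. irreducible_upset V (\<lambda>_. 1)"
  have pow: "k \<le> lookup m j" if "m \<in> sumset_power (?X {j}) k" for k m
    using that
  proof (induction k arbitrary: m)
    case (Suc k)
    then obtain u v where "m = u + v" "1 \<le> lookup u j" "v \<in> sumset_power (?X {j}) k"
      by (auto simp: sumset_def irreducible_upset_iff)
    then show ?case using Suc.IH[of v] by (simp add: lookup_add)
  qed simp
  \<comment> \<open>The exponent \<open>e j\<close> suffices: multiplication by the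
    \<open>e j\<close>-th power of x_j carries \<open>w\<close> into the component, hence into
    \<open>I\<close>.\<close>
  have "(monomial w :: ('n, 'k) mpoly) * g \<in> I" if g: "g \<in> ideal_power (ideal_gen {var j}) (e j)"
      for g
  proof -
    have "ideal_gen {var j :: ('n, 'k) mpoly} = monomial_span (?X {j})"
      using ideal_gen_vars[of "{j}"] by simp
    with g have "g \<in> monomial_span (sumset_power (?X {j}) (e j))"
        by (simp add: ideal_power_monomial_span)
    then have g: "e j \<le> lookup m j" if "m \<in> keys g" for m using that pow
        by (auto simp: monomial_span_def)
    have "w + m \<in> U" if "m \<in> keys g" for m
    proof -
      have "w + m \<in> irreducible_upset V e"
        using g[OF that] \<open>j \<in> V\<close>
            by (auto simp: irreducible_upset_iff lookup_add intro!: bexI[of _ j])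
      then show ?thesis using w(2)[of "w + m"] U(2) by simp
    qed
    then have "keys (monomial w * g) \<subseteq> U" using keys_mult[of "monomial w :: ('n, 'k) mpoly" g]
        by auto
    then show ?thesis using U(2) by (simp add: monomial_span_def)
  qed
  then have "monomial w \<in> saturation I (ideal_gen {var j})"
    by (auto simp: saturation_def colon_def)
  then have "monomial w \<in> saturation I (ideal_gen (var ` {..j}))"
    using assms(1) by (simp add: borel_type_def)
  then obtain k where k: "\<And>g. g \<in> ideal_power (ideal_gen (var ` {..j})) k \<Longrightarrow> monomial w * g \<in> I"
    by (auto simp: saturation_def colon_def)
  have "single i k \<in> sumset_power (?X {..j}) k"
  proof (induction k)
    case (Suc k)
    have "single i (Suc k) = single i 1 + single i k" by (simp flip: single_add)
    moreover have "single i 1 \<in> ?X {..j}"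
      using \<open>i \<le> j\<close> by (auto simp: irreducible_upset_iff intro!: bexI[of _ i])
    ultimately show ?case using Suc by (auto simp: sumset_def simp del: One_nat_def)
  qed simp
  then have "(monomial (single i k) :: ('n, 'k) mpoly) \<in> ideal_power (ideal_gen (var ` {..j})) k"
    by (simp add: ideal_gen_vars ideal_power_monomial_span)
  from k[OF this] have "monomial (w + single i k) \<in> I" by (simp add: monomial_mult)
  \<comment> \<open>A variable outside \<open>V\<close> leaves the exponents on \<open>V\<close>
    unchanged, so no power of it moves \<open>w\<close> into the component.\<close>
  moreover have "w + single i k \<notin> irreducible_upset V e"
    using w(1) \<open>i \<notin> V\<close> by (auto simp: irreducible_upset_iff lookup_add lookup_single when_def)
  ultimately show False using w(3) by blast
qed

section \<open>Koszul homology by multidegree\<close>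

lemma koszul_sign_square: "koszul_sign l \<sigma> * koszul_sign l \<sigma> = (1 :: 'k::field)"
  by (simp add: koszul_sign_def flip: power_mult_distrib)

lemma koszul_sign_swap:
  fixes k l :: "'n::{finite,linorder}"
  assumes "k \<notin> \<sigma>" "l \<notin> \<sigma>" "k \<noteq> l"
  shows "(koszul_sign k \<sigma> * koszul_sign l (insert k \<sigma>) :: 'k::field) =
    - (koszul_sign l \<sigma> * koszul_sign k (insert l \<sigma>))"
  using assms koszul_sign_insert_other[of k \<sigma> l, where 'k = 'k]
    koszul_sign_insert_other[of l \<sigma> k, where 'k = 'k]
  by (cases k l rule: linorder_cases) auto

definition squarefree :: "'n::finite set \<Rightarrow> ('n \<Rightarrow>\<^sub>0 nat)" where
  "squarefree \<tau> = Abs_poly_mapping (\<lambda>i. if i \<in> \<tau> then 1 else 0)"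

lemma lookup_squarefree [simp]: "lookup (squarefree \<tau>) i = (if i \<in> \<tau> then 1 else 0)"
  by (simp add: squarefree_def)

lemma squarefree_insert: "l \<notin> \<tau> \<Longrightarrow> squarefree (insert l \<tau>) = squarefree \<tau> + single l 1"
  by (intro poly_mapping_eqI) (auto simp: lookup_add lookup_single when_def)

lemma minus_squarefree_insert:
  "l \<notin> \<tau> \<Longrightarrow> b - squarefree (insert l \<tau>) = b - squarefree \<tau> - single l 1"
  by (simp add: squarefree_insert diff_diff_add)

lemma minus_squarefree_add:
  assumes "\<tau> \<subseteq> keys b" shows "b - squarefree \<tau> + squarefree \<tau> = b"
  using assms by (intro poly_mapping_eqI) (auto simp: lookup_add lookup_minus in_keys_iff)

lemma mdeg_add: "mdeg (a + b) = mdeg a + mdeg b"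
  by (simp add: mdeg_def lookup_add sum.distrib)

lemma mdeg_squarefree: "mdeg (squarefree \<tau>) = card \<tau>"
  by (simp add: mdeg_def sum.If_cases)

lemma mdeg_minus_squarefree: "\<tau> \<subseteq> keys b \<Longrightarrow> mdeg (b - squarefree \<tau>) + card \<tau> = mdeg b"
  by (metis mdeg_add mdeg_squarefree minus_squarefree_add)

lemma keys_add_squarefree: "\<tau> \<subseteq> keys (m + squarefree \<tau>)"
  by (auto simp: in_keys_iff lookup_add)

text \<open>
  Functions \<open>c\<close> on sets of variables, where \<open>c \<tau>\<close> is the coefficient of \<open>x\<^sup>b / x\<^sup>\<tau> e\<^sub>\<tau>\<close>, represent the elements
  of multidegree \<open>b\<close> in the Koszul complex of the ideal with exponent set \<open>U\<close>.
\<close>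

definition face_chain :: "('n::finite \<Rightarrow>\<^sub>0 nat) set \<Rightarrow> ('n \<Rightarrow>\<^sub>0 nat) \<Rightarrow> nat \<Rightarrow> ('n set \<Rightarrow> 'k::field) \<Rightarrow>
    bool" where
  "face_chain U b i c \<longleftrightarrow>
     (\<forall>\<tau>. c \<tau> \<noteq> 0 \<longrightarrow> card \<tau> = i \<and> \<tau> \<subseteq> keys b \<and> b - squarefree \<tau> \<in> U)"

text \<open>The Koszul differential in one multidegree. The factor x_l is invisible here, because it
  turns the monomial attached to \<open>insert l \<tau>\<close> into the one attached to
  \<open>\<tau>\<close>.\<close>

definition face_boundary :: "('n::{finite,linorder} set \<Rightarrow> 'k::field) \<Rightarrow> 'n set \<Rightarrow> 'k" where
  "face_boundary c \<tau> = (\<Sum>l\<in>- \<tau>. koszul_sign l \<tau> * c (insert l \<tau>))"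

text \<open>Subtraction of exponents is truncated, so without the guard a set \<open>\<tau>\<close>
  not contained in \<open>keys b\<close> would pick up a coefficient from another
  multidegree.\<close>

definition strand :: "('n::finite set \<Rightarrow>\<^sub>0 ('n, 'k::field) mpoly) \<Rightarrow> ('n \<Rightarrow>\<^sub>0 nat) \<Rightarrow> 'n set \<Rightarrow> 'k" where
  "strand v b \<tau> = (if \<tau> \<subseteq> keys b then lookup (lookup v \<tau>) (b - squarefree \<tau>) else 0)"

definition strand_element :: "('n::finite \<Rightarrow>\<^sub>0 nat) \<Rightarrow> ('n set \<Rightarrow> 'k::field) \<Rightarrow>
    ('n set \<Rightarrow>\<^sub>0 ('n, 'k) mpoly)" where
  "strand_element b c = (\<Sum>\<tau>\<in>Pow (keys b). single \<tau> (single (b - squarefree \<tau>) (c \<tau>)))"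

lemma lookup_eq_strand: "lookup (lookup v \<tau>) m = strand v (m + squarefree \<tau>) \<tau>"
  by (simp add: strand_def keys_add_squarefree)

text \<open>The term x^m e_\<tau> lives in the multidegree \<open>m + squarefree \<tau>\<close>, so
  the strands together see every coefficient.\<close>

lemma strand_eqI: "(\<And>b. strand v b = strand w b) \<Longrightarrow> v = w"
  by (intro poly_mapping_eqI) (simp add: lookup_eq_strand)

lemma strand_zero: "strand 0 b = (\<lambda>_. 0)"
  by (auto simp: strand_def fun_eq_iff)

lemma strand_sum: "strand (\<Sum>x\<in>X. v x) b \<tau> = (\<Sum>x\<in>X. strand (v x) b \<tau>)"
  by (simp add: strand_def lookup_sum)

lemma strand_add: "strand (v + w) b \<tau> = strand v b \<tau> + strand w b \<tau>"
  by (simp add: strand_def lookup_add)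

lemma lookup_strand_element:
  "lookup (lookup (strand_element b c) \<tau>) m =
    (if \<tau> \<subseteq> keys b \<and> m = b - squarefree \<tau> then c \<tau> else 0)"
proof -
  have "lookup (lookup (strand_element b c) \<tau>) m =
      (\<Sum>\<rho>\<in>Pow (keys b). if \<rho> = \<tau> then (if m = b - squarefree \<tau> then c \<tau> else 0) else 0)"
    unfolding strand_element_def lookup_sum
    by (intro sum.cong refl) (auto simp: lookup_single when_def)
  then show ?thesis by auto
qed

lemma strand_strand_element:
  assumes "face_chain U b i c"
  shows "strand (strand_element b c) b' = (if b' = b then c else (\<lambda>_. 0))"
proof
  fix \<tau>
  have "b' = b" if "\<tau> \<subseteq> keys b" "\<tau> \<subseteq> keys b'" "b' - squarefree \<tau> = b - squarefree \<tau>"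
    using that minus_squarefree_add by metis
  moreover have "c \<tau> = 0" if "\<not> \<tau> \<subseteq> keys b"
    using assms that unfolding face_chain_def by blast
  ultimately show "strand (strand_element b c) b' \<tau> = (if b' = b then c else (\<lambda>_. 0)) \<tau>"
    by (auto simp: strand_def lookup_strand_element)
qed

lemma strand_differential:
  fixes v :: "'n::{finite,linorder} set \<Rightarrow>\<^sub>0 ('n, 'k::field) mpoly"
  shows "strand (differential koszul i v) b = face_boundary (strand v b)"
proof
  fix \<tau>
  show "strand (differential koszul i v) b \<tau> = face_boundary (strand v b) \<tau>"
  proof (cases "\<tau> \<subseteq> keys b")
    case True
    have "strand (differential koszul i v) b \<tau> =
      (\<Sum>l\<in>UNIV. if l \<notin> \<tau> \<and> 0 < lookup (b - squarefree \<tau>) l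
       then koszul_sign l \<tau> * lookup (lookup v (insert l \<tau>)) (b - squarefree \<tau> - single l 1) else 0)"
      using True by (simp add: strand_def lookup_koszul_differential)
    also have "\<dots> = (\<Sum>l\<in>UNIV. if l \<in> - \<tau> then koszul_sign l \<tau> * strand v b (insert l \<tau>) else 0)"
      using True minus_squarefree_insert[of _ \<tau> b]
      by (intro sum.cong refl) (auto simp: strand_def lookup_minus in_keys_iff)
    also have "\<dots> = face_boundary (strand v b) \<tau>"
      by (simp add: face_boundary_def sum.If_cases Compl_eq)
    finally show ?thesis .
  next
    case False
    then show ?thesis by (simp add: strand_def face_boundary_def)
  qed
qed

lemma chains_koszul_monomial_span_iff:
  fixes v :: "'n::{finite,linorder} set \<Rightarrow>\<^sub>0 ('n, 'k::field) mpoly"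
  shows "v \<in> chains koszul (monomial_span U) i j \<longleftrightarrow>
    (\<forall>\<tau> m. lookup (lookup v \<tau>) m \<noteq> 0 \<longrightarrow> card \<tau> = i \<and> mdeg m + i = j \<and> m \<in> U)"
proof -
  have "v \<in> chains koszul (monomial_span U) i j \<longleftrightarrow>
      v \<in> chains koszul UNIV i j \<and>
          (\<forall>\<tau>\<in>basis (koszul :: ('n set, 'n, 'k) free_complex) i. keys (lookup v \<tau>) \<subseteq> U)"
    unfolding chains_def monomial_span_def by auto
  moreover have "(\<forall>\<tau>\<in>basis (koszul :: ('n set, 'n, 'k) free_complex) i. keys (lookup v \<tau>) \<subseteq> U) \<longleftrightarrow>
      (\<forall>\<tau>. card \<tau> = i \<longrightarrow> (\<forall>m. lookup (lookup v \<tau>) m \<noteq> 0 \<longrightarrow> m \<in> U))"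
    by (simp add: koszul_def subset_iff in_keys_iff)
  ultimately show ?thesis
    unfolding chains_koszul_iff by blast
qed

lemma chains_koszul_strands_iff:
  fixes v :: "'n::{finite,linorder} set \<Rightarrow>\<^sub>0 ('n, 'k::field) mpoly"
  shows "v \<in> chains koszul (monomial_span U) i j \<longleftrightarrow>
    (\<forall>b. face_chain U b i (strand v b) \<and> (strand v b \<noteq> (\<lambda>_. 0) \<longrightarrow> mdeg b = j))"
proof
  assume L: "v \<in> chains koszul (monomial_span U) i j"
  show "\<forall>b. face_chain U b i (strand v b) \<and> (strand v b \<noteq> (\<lambda>_. 0) \<longrightarrow> mdeg b = j)"
  proof
    fix b
    have *: "card \<tau> = i \<and> mdeg b = j \<and> \<tau> \<subseteq> keys b \<and>
        b - squarefree \<tau> \<in> U" if "strand v b \<tau> \<noteq> 0" for \<tau>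
      using that L mdeg_minus_squarefree[of \<tau> b] unfolding chains_koszul_monomial_span_iff
      by (auto simp: strand_def split: if_splits)
    then show "face_chain U b i (strand v b) \<and> (strand v b \<noteq> (\<lambda>_. 0) \<longrightarrow> mdeg b = j)"
      unfolding face_chain_def fun_eq_iff by blast
  qed
next
  assume R: "\<forall>b. face_chain U b i (strand v b) \<and> (strand v b \<noteq> (\<lambda>_. 0) \<longrightarrow> mdeg b = j)"
  show "v \<in> chains koszul (monomial_span U) i j"
    unfolding chains_koszul_monomial_span_iff lookup_eq_strand
  proof (intro allI impI)
    fix \<tau> m assume nz: "strand v (m + squarefree \<tau>) \<tau> \<noteq> 0"
    then have "strand v (m + squarefree \<tau>) \<noteq> (\<lambda>_. 0)" by auto
    with R have "mdeg (m + squarefree \<tau>) = j" by blast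
    moreover have "card \<tau> = i \<and> m + squarefree \<tau> - squarefree \<tau> \<in> U"
      using R nz unfolding face_chain_def by blast
    ultimately show "card \<tau> = i \<and> mdeg m + i = j \<and> m \<in> U"
      by (simp add: mdeg_add mdeg_squarefree)
  qed
qed

lemma strand_element_chain:
  fixes c :: "'n::{finite,linorder} set \<Rightarrow> 'k::field"
  assumes "face_chain U b i c"
  shows "strand_element b c \<in> chains koszul (monomial_span U) i (mdeg b)"
  unfolding chains_koszul_strands_iff strand_strand_element[OF assms]
  using assms by (auto simp: face_chain_def)

lemma face_boundary_zero [simp]: "face_boundary (\<lambda>_. 0) = (\<lambda>_. 0)"
  by (simp add: face_boundary_def fun_eq_iff)

text \<open>Realizing \<open>c\<close> as a strand of an element of the Koszul complex reduces this
  to the identity for the Koszul differential, with no new sign computation.\<close>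

lemma face_boundary_face_boundary:
  fixes c :: "'n::{finite,linorder} set \<Rightarrow> 'k::field"
  assumes "face_chain U b i c"
  shows "face_boundary (face_boundary c) = (\<lambda>_. 0)"
proof -
  have "face_boundary (face_boundary c) =
      strand (differential koszul i (differential koszul i (strand_element b c))) b"
    by (simp add: strand_differential strand_strand_element[OF assms])
  then show ?thesis by (simp add: differential_koszul_differential strand_zero)
qed

lemma face_boundary_chain:
  fixes c :: "'n::{finite,linorder} set \<Rightarrow> 'k::field"
  assumes "upset U" "face_chain U b (Suc i) c"
  shows "face_chain U b i (face_boundary c)"
  unfolding face_chain_def
proof (intro allI impI)
  fix \<tau> assume "face_boundary c \<tau> \<noteq> 0"
  then obtain l where l: "l \<notin> \<tau>" "c (insert l \<tau>) \<noteq> 0"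
    unfolding face_boundary_def
    by (metis (no_types, lifting) ComplD mult_zero_right sum.not_neutral_contains_not_neutral)
  then have "card (insert l \<tau>) = Suc i" "insert l \<tau> \<subseteq> keys b" "b - squarefree (insert l \<tau>) \<in> U"
    using assms(2) unfolding face_chain_def by blast+
  moreover have "b - squarefree (insert l \<tau>) \<preceq> b - squarefree \<tau>"
    unfolding minus_squarefree_insert[OF l(1)] by (rule divides_minus)
  ultimately show "card \<tau> = i \<and> \<tau> \<subseteq> keys b \<and> b - squarefree \<tau> \<in> U"
    using l(1) upsetD[OF assms(1)] by simp
qed

lemma face_boundary_add:
  "face_boundary (\<lambda>\<tau>. c \<tau> + c' \<tau>) \<tau> = face_boundary c \<tau> + face_boundary c' \<tau>"
  by (simp add: face_boundary_def algebra_simps sum.distrib)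

text \<open>The exception for \<open>i = 0\<close> in \<open>cycles\<close> is harmless: chains of
  degree 0 are supported on the empty set, and the formula for the differential kills them.\<close>

lemma cycles_koszul_eq:
  "cycles koszul (monomial_span U) i j = {v :: 'n::{finite,linorder} set \<Rightarrow>\<^sub>0 ('n, 'k::field) mpoly. v \<in> chains koszul (monomial_span U) i j \<and> differential koszul i v = 0}"
proof -
  have "differential koszul 0 v = 0" if "v \<in> chains koszul (monomial_span U) 0 j"
    for v :: "'n set \<Rightarrow>\<^sub>0 ('n, 'k) mpoly"
  proof (rule strand_eqI)
    fix b
    have "strand v b \<tau> = 0" if "\<tau> \<noteq> {}" for \<tau>
    proof -
      have "face_chain U b 0 (strand v b)"
        using \<open>v \<in> _\<close> unfolding chains_koszul_strands_iff by simp
      then show ?thesis using that unfolding face_chain_def by fastforce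
    qed
    then show "strand (differential koszul 0 v) b = strand 0 b"
      by (simp add: strand_differential strand_zero face_boundary_def fun_eq_iff)
  qed
  then show ?thesis by (auto simp: cycles_def)
qed

section \<open>Acyclic multidegrees and Betti numbers\<close>

text \<open>
  The homology in degree \<open>i\<close> and multidegree \<open>b\<close> of the Koszul complex on the variables in \<open>T\<close>
  vanishes.
\<close>

definition acyclic_on ::
    "'n::{finite,linorder} set \<Rightarrow> ('n \<Rightarrow>\<^sub>0 nat) set \<Rightarrow> ('n \<Rightarrow>\<^sub>0 nat) \<Rightarrow> nat \<Rightarrow> 'k::field itself \<Rightarrow>
        bool" where
  "acyclic_on T U b i _ \<longleftrightarrow> (\<forall>c :: 'n set \<Rightarrow> 'k.
     face_chain U b i c \<longrightarrow> (\<forall>\<tau>. c \<tau> \<noteq> 0 \<longrightarrow> \<tau> \<subseteq> T) \<longrightarrow> face_boundary c = (\<lambda>_. 0) \<longrightarrow>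
     (\<exists>y. face_chain U b (Suc i) y \<and> (\<forall>\<tau>. y \<tau> \<noteq> 0 \<longrightarrow> \<tau> \<subseteq> T) \<and> face_boundary y = c))"

abbreviation acyclic_at ::
    "('n::{finite,linorder} \<Rightarrow>\<^sub>0 nat) set \<Rightarrow> ('n \<Rightarrow>\<^sub>0 nat) \<Rightarrow> nat \<Rightarrow> 'k::field itself \<Rightarrow> bool" where
  "acyclic_at \<equiv> acyclic_on UNIV"

lemma acyclic_at_iff:
  fixes U :: "('n::{finite,linorder} \<Rightarrow>\<^sub>0 nat) set"
  shows "acyclic_at U b i TYPE('k::field) \<longleftrightarrow> (\<forall>c :: 'n set \<Rightarrow> 'k.
    face_chain U b i c \<longrightarrow> face_boundary c = (\<lambda>_. 0) \<longrightarrow>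
    (\<exists>y. face_chain U b (Suc i) y \<and> face_boundary y = c))"
  by (simp add: acyclic_on_def)

lemma boundaries_subset_cycles:
  fixes U :: "('n::{finite,linorder} \<Rightarrow>\<^sub>0 nat) set"
  assumes "upset U"
  shows "boundaries koszul (monomial_span U) i j \<subseteq> (cycles koszul (monomial_span U) i j :: ('n set \<Rightarrow>\<^sub>0 ('n, 'k::field) mpoly) set)"
proof -
  have "differential koszul (Suc i) v \<in> chains koszul (monomial_span U) i j"
    if "v \<in> chains koszul (monomial_span U) (Suc i) j" for v :: "'n set \<Rightarrow>\<^sub>0 ('n, 'k) mpoly"
    using that face_boundary_chain[OF assms]
    unfolding chains_koszul_strands_iff strand_differential by force
  then show ?thesis
    unfolding cycles_koszul_eq boundaries_def
    by (auto simp: differential_koszul_differential)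
qed

text \<open>A cycle is lifted multidegree by multidegree, and the lifts are added up; only finitely
  many strands are nonzero.\<close>

lemma cycles_subset_boundaries:
  fixes U :: "('n::{finite,linorder} \<Rightarrow>\<^sub>0 nat) set"
  assumes "\<And>b. mdeg b = j \<Longrightarrow> acyclic_at U b i TYPE('k::field)"
  shows "(cycles koszul (monomial_span U) i j :: ('n set \<Rightarrow>\<^sub>0 ('n, 'k) mpoly) set) \<subseteq> boundaries koszul (monomial_span U) i j"
proof
  fix v :: "'n set \<Rightarrow>\<^sub>0 ('n, 'k) mpoly"
  assume "v \<in> cycles koszul (monomial_span U) i j"
  then have v: "v \<in> chains koszul (monomial_span U) i j" "differential koszul i v = 0"
    by (auto simp: cycles_koszul_eq)
  define B where "B = (\<Union>\<tau>\<in>UNIV. (\<lambda>m. m + squarefree \<tau>) ` keys (lookup v \<tau>))"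
  have B: "strand v b = (\<lambda>_. 0)" if "b \<notin> B" for b
  proof
    fix \<tau>
    show "strand v b \<tau> = 0"
    proof (rule ccontr)
      assume "strand v b \<tau> \<noteq> 0"
      then have "\<tau> \<subseteq> keys b" "b - squarefree \<tau> \<in> keys (lookup v \<tau>)"
        by (auto simp: strand_def in_keys_iff split: if_splits)
      then have "b \<in> (\<lambda>m. m + squarefree \<tau>) ` keys (lookup v \<tau>)"
        by (intro image_eqI[of _ _ "b - squarefree \<tau>"]) (simp_all add: minus_squarefree_add)
      then have "b \<in> B" unfolding B_def by blast
      with that show False by simp
    qed
  qed
  \<comment> \<open>Outside degree \<open>j\<close> the lift is chosen to be 0, so that the
    assembled element is homogeneous.\<close>
  have "\<exists>y. face_chain U b (Suc i) y \<and> face_boundary y = strand v b \<and>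
      (mdeg b \<noteq> j \<longrightarrow> y = (\<lambda>_. 0))" for b
  proof (cases "mdeg b = j")
    case True
    have "face_chain U b i (strand v b)" using v(1) unfolding chains_koszul_strands_iff by blast
    moreover have "face_boundary (strand v b) = (\<lambda>_. 0)"
      using v(2) by (simp add: strand_zero flip: strand_differential[of i])
    ultimately show ?thesis using assms[OF True] True unfolding acyclic_at_iff by blast
  next
    case False
    then have "strand v b = (\<lambda>_. 0)" using v(1) unfolding chains_koszul_strands_iff by blast
    then show ?thesis by (intro exI[of _ "\<lambda>_. 0"]) (simp add: face_chain_def)
  qed
  then obtain y where y: "\<And>b. face_chain U b (Suc i) (y b)" "\<And>b. face_boundary (y b) = strand v b"
      "\<And>b. mdeg b \<noteq> j \<Longrightarrow> y b = (\<lambda>_. 0)"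
    by metis
  define w where "w = (\<Sum>b\<in>B. strand_element b (y b))"
  have "finite B" by (simp add: B_def)
  then have w: "strand w b = (if b \<in> B then y b else (\<lambda>_. 0))" for b
    by (auto simp: w_def strand_sum strand_strand_element[OF y(1)] fun_eq_iff if_distrib[of "\<lambda>f. f _"] cong: if_cong)
  have "w \<in> chains koszul (monomial_span U) (Suc i) j"
    unfolding chains_koszul_strands_iff w using y(1,3) by (auto simp: face_chain_def)
  moreover have "differential koszul (Suc i) w = v"
    by (rule strand_eqI) (auto simp: strand_differential w y(2) B)
  ultimately show "v \<in> boundaries koszul (monomial_span U) i j"
    unfolding boundaries_def by blast
qed

lemma betti_nonzeroD:
  fixes U :: "('n::{finite,linorder} \<Rightarrow>\<^sub>0 nat) set"
  assumes "upset U" "betti (monomial_span U :: ('n, 'k::field) mpoly set) i j \<noteq> 0"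
  shows "\<exists>b. mdeg b = j \<and> \<not> acyclic_at U b i TYPE('k)"
proof (rule ccontr)
  assume "\<not> ?thesis"
  then have "(cycles koszul (monomial_span U) i j :: ('n set \<Rightarrow>\<^sub>0 ('n, 'k) mpoly) set) = boundaries koszul (monomial_span U) i j"
    by (intro equalityI cycles_subset_boundaries boundaries_subset_cycles assms(1)) auto
  with assms(2) show False by (simp add: betti_def tor_dim_def)
qed

lemma differential_linear:
  fixes v w :: "'n::{finite,linorder} set \<Rightarrow>\<^sub>0 ('n, 'k::field) mpoly"
  shows "differential koszul i (v + w) = differential koszul i v + differential koszul i w"
    and "differential koszul i (cscale a v) = cscale a (differential koszul i v)"
    and "differential koszul i (0 :: 'n set \<Rightarrow>\<^sub>0 ('n, 'k) mpoly) = 0"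
proof -
  have scale: "strand (cscale a v) b \<tau> = a * strand v b \<tau>" for b \<tau>
      and v :: "'n set \<Rightarrow>\<^sub>0 ('n, 'k) mpoly"
  proof -
    have "lookup (const a * p) m = a * lookup p m" for p :: "('n, 'k) mpoly" and m
      unfolding const_def by (simp add: lookup_mult lookup_single when_mult)
    then show ?thesis by (simp add: strand_def cscale_def)
  qed
  show "differential koszul i (v + w) = differential koszul i v + differential koszul i w"
    by (rule strand_eqI)
       (simp add: strand_differential strand_add fun_eq_iff face_boundary_def algebra_simps sum.distrib)
  show "differential koszul i (cscale a v) = cscale a (differential koszul i v)"
    by (rule strand_eqI)
       (simp add: strand_differential scale fun_eq_iff face_boundary_def sum_distrib_left mult.left_commute)
  show "differential koszul i (0 :: 'n set \<Rightarrow>\<^sub>0 ('n, 'k) mpoly) = 0"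
    by (rule strand_eqI) (simp add: strand_differential strand_zero)
qed

text \<open>\<open>tor_dim\<close> is a difference of dimensions, so a nonzero class must yield a
  strict inequality: a basis of \<open>S\<close> together with \<open>z\<close> stays independent in
  \<open>T\<close>. The finite set \<open>B\<close> excludes infinite bases, whose cardinality would
  be 0.\<close>

lemma (in vector_space) dim_strict_mono:
  assumes "subspace S" "S \<subseteq> T" "z \<in> T" "z \<notin> S" "T \<subseteq> span B" "finite B"
  shows "dim S < dim T"
proof -
  obtain A where A: "A \<subseteq> S" "independent A" "S \<subseteq> span A" "card A = dim S"
    by (rule basis_exists)
  have "span A \<subseteq> S" using A(1) assms(1) by (rule span_minimal)
  with assms(4) have "z \<notin> span A" by blast
  then have indep: "independent (insert z A)" and "z \<notin> A"
    using A(2) independent_insertI span_base by blast+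
  obtain A' where A': "insert z A \<subseteq> A'" "A' \<subseteq> T" "independent A'" "T \<subseteq> span A'"
    using maximal_independent_subset_extend[OF _ indep, of T] A(1) assms(2,3) by blast
  have "finite A'" using independent_span_bound[OF assms(6) A'(3)] A'(2) assms(5) by blast
  then have "card (insert z A) \<le> card A'" "finite A"
    using A'(1) finite_subset[of A A'] by (simp_all add: card_mono)
  then show ?thesis
    using A(4) \<open>z \<notin> A\<close> basis_card_eq_dim[OF A'(2,4,3)] by simp
qed

lemma finite_bounded_mdeg: "finite {m :: 'n::finite \<Rightarrow>\<^sub>0 nat. mdeg m \<le> j}"
proof (rule finite_imageD)
  have "lookup m i \<le> j" if "mdeg m \<le> j" for m :: "'n \<Rightarrow>\<^sub>0 nat" and i
    using that member_le_sum[of i UNIV "lookup m"] by (simp add: mdeg_def)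
  then have "lookup ` {m :: 'n \<Rightarrow>\<^sub>0 nat. mdeg m \<le> j} \<subseteq>
      {f. \<forall>i. (i \<in> UNIV \<longrightarrow> f i \<in> {..j}) \<and> (i \<notin> UNIV \<longrightarrow> f i = 0)}"
    by auto
  then show "finite (lookup ` {m :: 'n \<Rightarrow>\<^sub>0 nat. mdeg m \<le> j})"
    by (rule finite_subset) (intro finite_set_of_finite_funs; simp)
  show "inj_on lookup {m :: 'n \<Rightarrow>\<^sub>0 nat. mdeg m \<le> j}"
    by (auto intro!: inj_onI poly_mapping_eqI)
qed

text \<open>A cycle of the strand at \<open>b\<close> that bounds nothing there stays a non-boundary
  in the whole complex, since the strand of a boundary is a boundary.\<close>

lemma betti_nonzeroI:
  fixes U :: "('n::{finite,linorder} \<Rightarrow>\<^sub>0 nat) set"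
  assumes "upset U" "\<not> acyclic_at U b i TYPE('k::field)"
  shows "betti (monomial_span U :: ('n, 'k) mpoly set) i (mdeg b) \<noteq> 0"
proof -
  interpret vs: vector_space "cscale :: 'k \<Rightarrow> ('n set \<Rightarrow>\<^sub>0 ('n, 'k) mpoly) \<Rightarrow> _"
    by (rule vector_space_cscale)
  let ?j = "mdeg b"
  let ?C = "\<lambda>i. chains koszul (monomial_span U) i ?j :: ('n set \<Rightarrow>\<^sub>0 ('n, 'k) mpoly) set"
  let ?Z = "cycles koszul (monomial_span U) i ?j :: ('n set \<Rightarrow>\<^sub>0 ('n, 'k) mpoly) set"
  let ?B = "boundaries koszul (monomial_span U) i ?j :: ('n set \<Rightarrow>\<^sub>0 ('n, 'k) mpoly) set"
  obtain c :: "'n set \<Rightarrow> 'k" where c: "face_chain U b i c" "face_boundary c = (\<lambda>_. 0)"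
    and nb: "\<And>y. face_chain U b (Suc i) y \<Longrightarrow> face_boundary y \<noteq> c"
    using assms(2) unfolding acyclic_at_iff by blast
  have single: "cscale a (single \<tau> (single m x)) = single \<tau> (single m (a * x))" for a x :: 'k
      and \<tau> :: "'n set" and m
    by (intro poly_mapping_eqI) (simp add: cscale_def const_def mult_single lookup_single when_def)
  have scale: "lookup (lookup (cscale a v) \<tau>) m = a * lookup (lookup v \<tau>) m" for a \<tau> m
      and v :: "'n set \<Rightarrow>\<^sub>0 ('n, 'k) mpoly"
    by (simp add: cscale_def const_def lookup_mult lookup_single when_mult)
  have sub: "vs.subspace (?C i)" for i
    unfolding chains_koszul_monomial_span_iff[abs_def]
    by (rule vs.subspaceI) (auto simp: chains_koszul_monomial_span_iff lookup_add scale, (metis add_0)+)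
  have "vs.subspace ?B"
    unfolding boundaries_def
  proof (rule vs.subspaceI)
    show "0 \<in> differential koszul (Suc i) ` ?C (Suc i)"
      using vs.subspace_0[OF sub] differential_linear(3) by (metis image_eqI)
  next
    fix x y assume "x \<in> differential koszul (Suc i) ` ?C (Suc i)" "y \<in> differential koszul (Suc i) ` ?C (Suc i)"
    then show "x + y \<in> differential koszul (Suc i) ` ?C (Suc i)"
      using vs.subspace_add[OF sub] by (auto simp flip: differential_linear(1))
  next
    fix a x assume "x \<in> differential koszul (Suc i) ` ?C (Suc i)"
    then show "cscale a x \<in> differential koszul (Suc i) ` ?C (Suc i)"
      using vs.subspace_scale[OF sub] by (auto simp flip: differential_linear(2))
  qed
  moreover have "?B \<subseteq> ?Z" by (rule boundaries_subset_cycles[OF assms(1)])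
  moreover have "strand_element b c \<in> ?Z"
  proof -
    have "differential koszul i (strand_element b c) = 0"
      by (rule strand_eqI) (simp add: strand_differential strand_strand_element[OF c(1)] c(2) strand_zero)
    then show ?thesis using strand_element_chain[OF c(1)] by (simp add: cycles_koszul_eq)
  qed
  moreover have "strand_element b c \<notin> ?B"
  proof
    assume "strand_element b c \<in> ?B"
    then obtain w where w: "w \<in> ?C (Suc i)" "strand_element b c = differential koszul (Suc i) w"
      unfolding boundaries_def by blast
    have "face_boundary (strand w b) = c"
      using strand_strand_element[OF c(1), of b] by (simp add: w(2) strand_differential)
    then show False using nb[of "strand w b"] w(1) unfolding chains_koszul_strands_iff by blast
  qed
  \<comment> \<open>A finite spanning set for the dimension count; the degree bound is coarse, as in
    chains \<open>mdeg m\<close> is exactly \<open>?j - i\<close>.\<close>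
  moreover define X :: "('n set \<Rightarrow>\<^sub>0 ('n, 'k) mpoly) set"
    where "X = (\<lambda>(\<tau>, m). single \<tau> (single m 1)) ` (UNIV \<times> {m. mdeg m \<le> ?j})"
  moreover have "finite X" by (simp add: X_def finite_bounded_mdeg)
  moreover have "?Z \<subseteq> vs.span X"
  proof
    fix v assume "v \<in> ?Z"
    then have v: "v \<in> ?C i" by (simp add: cycles_def)
    have "v = (\<Sum>\<tau>\<in>UNIV. \<Sum>m\<in>keys (lookup v \<tau>). cscale (lookup (lookup v \<tau>) m) (single \<tau> (single m 1)))"
    proof (intro poly_mapping_eqI)
      fix \<sigma> m
      have "lookup (lookup (\<Sum>\<tau>\<in>UNIV. \<Sum>m\<in>keys (lookup v \<tau>).
            cscale (lookup (lookup v \<tau>) m) (single \<tau> (single m 1))) \<sigma>) m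
          = (\<Sum>\<tau>\<in>UNIV. if \<tau> = \<sigma> then lookup (lookup v \<sigma>) m else 0)"
        unfolding lookup_sum
        by (intro sum.cong refl) (auto simp: single lookup_single when_def in_keys_iff)
      then show "lookup (lookup v \<sigma>) m = lookup (lookup (\<Sum>\<tau>\<in>UNIV. \<Sum>m\<in>keys (lookup v \<tau>).
            cscale (lookup (lookup v \<tau>) m) (single \<tau> (single m 1))) \<sigma>) m" by simp
    qed
    also have "\<dots> \<in> vs.span X"
    proof (intro vs.span_sum vs.span_scale vs.span_base)
      fix \<tau> m assume "m \<in> keys (lookup v \<tau>)"
      then have "mdeg m + i = ?j" using v unfolding chains_koszul_monomial_span_iff in_keys_iff
          by blast
      then have "mdeg m \<le> ?j" by simp
      then show "single \<tau> (single m 1) \<in> X" unfolding X_def by auto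
    qed
    finally show "v \<in> vs.span X" .
  qed
  ultimately have "vs.dim ?B < vs.dim ?Z" using vs.dim_strict_mono by blast
  then show ?thesis by (simp add: betti_def tor_dim_def)
qed

section \<open>Vanishing above the degree bound\<close>

lemma acyclic_at_of_large_degree:
  fixes U :: "('n::{finite,linorder} \<Rightarrow>\<^sub>0 nat) set"
  assumes "upset U"
    and div: "\<And>u. u \<in> U \<Longrightarrow> d < mdeg u \<Longrightarrow> u - single (Max (keys u)) 1 \<in> U"
    and b: "d + i < mdeg b"
  shows "acyclic_at U b i TYPE('k::field)"
  unfolding acyclic_at_iff
proof (intro allI impI)
  fix c :: "'n set \<Rightarrow> 'k"
  assume c: "face_chain U b i c" and cyc: "face_boundary c = (\<lambda>_. 0)"
  have "keys b \<noteq> {}" using b by (auto simp: mdeg_def)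
  define l where "l = Max (keys b)"
  have l: "l \<in> keys b" "\<And>k. k \<in> keys b \<Longrightarrow> k \<le> l"
    using \<open>keys b \<noteq> {}\<close> by (auto simp: l_def)
  \<comment> \<open>The cone construction: \<open>y\<close> is the exterior product of
    \<open>c\<close> with e_l. If \<open>\<rho>\<close> lacks \<open>l\<close>, then x_l is the
    largest variable of \<open>b - squarefree \<rho>\<close>, whose degree exceeds \<open>d\<close>,
    so dividing by x_l stays in \<open>U\<close> by \<open>div\<close>.\<close>
  define y where "y \<tau> = (if l \<in> \<tau> then koszul_sign l (\<tau> - {l}) * c (\<tau> - {l}) else 0)" for \<tau>
  have "face_chain U b (Suc i) y"
    unfolding face_chain_def
  proof (intro allI impI)
    fix \<tau> assume "y \<tau> \<noteq> 0"
    then obtain \<rho> where \<rho>: "\<tau> = insert l \<rho>" "l \<notin> \<rho>" "c \<rho> \<noteq> 0"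
      by (metis Diff_insert_absorb insert_Diff mk_disjoint_insert mult_zero_right y_def)
    let ?u = "b - squarefree \<rho>"
    have u: "card \<rho> = i" "\<rho> \<subseteq> keys b" "?u \<in> U"
      using c \<rho>(3) unfolding face_chain_def by blast+
    have "d < mdeg ?u" using b mdeg_minus_squarefree[OF u(2)] u(1) by simp
    moreover have "Max (keys ?u) = l"
    proof (rule Max_eqI)
      show "k \<le> l" if "k \<in> keys ?u" for k
        using that l(2)[of k] by (auto simp: in_keys_iff lookup_minus)
      show "l \<in> keys ?u" using l(1) \<rho>(2) by (simp add: in_keys_iff lookup_minus)
    qed simp
    ultimately have "?u - single l 1 \<in> U" using div[OF u(3)] by simp
    then show "card \<tau> = Suc i \<and> \<tau> \<subseteq> keys b \<and> b - squarefree \<tau> \<in> U"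
      using u l(1) \<rho>(1,2) minus_squarefree_insert[OF \<rho>(2), of b] by simp
  qed
  moreover have "face_boundary y = c"
  proof
    fix \<tau>
    show "face_boundary y \<tau> = c \<tau>"
    proof (cases "l \<in> \<tau>")
      case False
      have "face_boundary y \<tau> = (\<Sum>k\<in>- \<tau>. if k = l then c \<tau> else 0)"
        unfolding face_boundary_def y_def using False
        by (intro sum.cong refl) (auto simp: koszul_sign_square simp flip: mult.assoc)
      then show ?thesis using False by simp
    next
      case True
      then obtain \<rho> where \<rho>: "\<tau> = insert l \<rho>" "l \<notin> \<rho>" by (meson mk_disjoint_insert)
      let ?s = "\<lambda>k \<sigma>. koszul_sign k \<sigma> :: 'k"
      have Compl: "- \<rho> = insert l (- \<tau>)" "l \<notin> - \<tau>" using \<rho> by auto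
      \<comment> \<open>The cycle condition at \<open>\<rho>\<close> expresses
        \<open>c \<tau>\<close> through the other faces \<open>insert k \<rho>\<close>, which are
        the ones that occur in \<open>face_boundary y \<tau>\<close>.\<close>
      have "0 = face_boundary c \<rho>" by (simp add: cyc)
      also have "\<dots> = ?s l \<rho> * c \<tau> + (\<Sum>k\<in>- \<tau>. ?s k \<rho> * c (insert k \<rho>))"
        unfolding face_boundary_def Compl(1) using Compl(2) \<rho>(1) by simp
      finally have *: "(\<Sum>k\<in>- \<tau>. ?s k \<rho> * c (insert k \<rho>)) = - (?s l \<rho> * c \<tau>)"
        by (simp add: eq_neg_iff_add_eq_0 add.commute)
      have "face_boundary y \<tau> = (\<Sum>k\<in>- \<tau>. - ?s l \<rho> * (?s k \<rho> * c (insert k \<rho>)))"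
        unfolding face_boundary_def
      proof (intro sum.cong refl)
        fix k assume "k \<in> - \<tau>"
        then have k: "k \<notin> \<rho>" "k \<noteq> l" using \<rho> by auto
        then have "insert k \<tau> - {l} = insert k \<rho>" using \<rho> by auto
        then have "?s k \<tau> * y (insert k \<tau>) = ?s k (insert l \<rho>) * ?s l (insert k \<rho>) * c (insert k \<rho>)"
          using \<rho>(1) by (simp add: y_def)
        \<comment> \<open>A squared sign is inserted so that \<open>koszul_sign_swap\<close>
          applies.\<close>
        also have "?s k (insert l \<rho>) * ?s l (insert k \<rho>)
            = ?s k \<rho> * ?s k \<rho> * (?s k (insert l \<rho>) * ?s l (insert k \<rho>))"
          by (simp add: koszul_sign_square)
        also have "\<dots> = ?s k \<rho> * ?s k (insert l \<rho>) * (?s k \<rho> * ?s l (insert k \<rho>))"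
          by (simp only: mult_ac)
        also have "\<dots> = - (?s k \<rho> * ?s l \<rho> * (?s k (insert l \<rho>) * ?s k (insert l \<rho>)))"
          unfolding koszul_sign_swap[OF k(1) \<rho>(2) k(2)] by (simp add: mult_ac)
        finally show "?s k \<tau> * y (insert k \<tau>) = - ?s l \<rho> * (?s k \<rho> * c (insert k \<rho>))"
          by (simp add: koszul_sign_square mult_ac)
      qed
      also have "\<dots> = ?s l \<rho> * ?s l \<rho> * c \<tau>"
        unfolding sum_distrib_left[symmetric] * by simp
      finally show ?thesis by (simp add: koszul_sign_square)
    qed
  qed
  ultimately show "\<exists>y. face_chain U b (Suc i) y \<and> face_boundary y = c" by blast
qed

section \<open>Bounds for the regularity\<close>

text \<open>
  The strands of \<open>T \<union> {l}\<close> form the mapping cone of multiplication by \<open>x\<^sub>l\<close> on the strands of \<open>T\<close>. If all cones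
  have vanishing homology, then these multiplications are surjective on homology, and the homology in
  the strands of \<open>T\<close> vanishes by descent on the exponent of \<open>x\<^sub>l\<close>.
\<close>

lemma acyclic_on_insertD:
  fixes U :: "('n::{finite,linorder} \<Rightarrow>\<^sub>0 nat) set"
  assumes "upset U" "l \<notin> V" "l \<notin> T"
    and acyc: "\<And>b. \<forall>k\<in>V. lookup b k = a k \<Longrightarrow> acyclic_on (insert l T) U b i TYPE('k::field)"
    and "\<forall>k\<in>V. lookup b k = a k"
  shows "acyclic_on T U b i TYPE('k)"
  using \<open>\<forall>k\<in>V. lookup b k = a k\<close>
proof (induction "lookup b l" arbitrary: b rule: less_induct)
  case less
  show ?case
    unfolding acyclic_on_def
  proof (intro allI impI)
    fix z :: "'n set \<Rightarrow> 'k"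
    assume z: "face_chain U b i z" "\<forall>\<tau>. z \<tau> \<noteq> 0 \<longrightarrow> \<tau> \<subseteq> T" "face_boundary z = (\<lambda>_. 0)"
    obtain y where y: "face_chain U b (Suc i) y" "\<forall>\<tau>. y \<tau> \<noteq> 0 \<longrightarrow> \<tau> \<subseteq> insert l T" "face_boundary y = z"
      using acyc[OF less.prems] z unfolding acyclic_on_def by (meson subset_insertI2)
    \<comment> \<open>\<open>y\<close> is split into its part \<open>y0\<close> without
      \<open>l\<close> and its coefficient \<open>y1\<close> of e_l. Then \<open>z\<close> is the
      boundary of \<open>y0\<close> plus \<open>y1\<close>, and \<open>y1\<close> is a cycle already
      in the multidegree divided by x_l.\<close>
    define y0 where "y0 \<tau> = (if l \<in> \<tau> then 0 else y \<tau>)" for \<tau>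
    define y1 where "y1 \<tau> = (if l \<in> \<tau> then 0 else koszul_sign l \<tau> * y (insert l \<tau>))" for \<tau>
    have y0: "face_chain U b (Suc i) y0" "\<forall>\<tau>. y0 \<tau> \<noteq> 0 \<longrightarrow> \<tau> \<subseteq> T"
      using y(1,2) by (auto simp: face_chain_def y0_def)
    have z_eq: "z \<tau> = face_boundary y0 \<tau> + y1 \<tau>" for \<tau>
    proof (cases "l \<in> \<tau>")
      case True
      then have "z \<tau> = 0" using z(2) assms(3) by blast
      with True show ?thesis by (simp add: face_boundary_def y0_def y1_def)
    next
      case False
      then have Compl: "- \<tau> = insert l (- insert l \<tau>)" by auto
      have "z \<tau> = y1 \<tau> + (\<Sum>k\<in>- insert l \<tau>. koszul_sign k \<tau> * y (insert k \<tau>))"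
        unfolding y(3)[symmetric] face_boundary_def using False by (subst Compl) (simp add: y1_def)
      also have "(\<Sum>k\<in>- insert l \<tau>. koszul_sign k \<tau> * y (insert k \<tau>)) = face_boundary y0 \<tau>"
        unfolding face_boundary_def using False
            by (subst Compl) (auto simp: y0_def intro!: sum.cong split: if_splits)
      finally show ?thesis by simp
    qed
    have y1_face: "card \<rho> = i \<and> l \<notin> \<rho> \<and> insert l \<rho> \<subseteq> keys b \<and> b - squarefree (insert l \<rho>) \<in> U \<and>
        \<rho> \<subseteq> T"
      if "y1 \<rho> \<noteq> 0" for \<rho>
    proof -
      have "l \<notin> \<rho>" "y (insert l \<rho>) \<noteq> 0" using that by (auto simp: y1_def split: if_splits)
      moreover from this have "card (insert l \<rho>) = Suc i \<and> insert l \<rho> \<subseteq> keys b \<and>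
          b - squarefree (insert l \<rho>) \<in> U"
        "insert l \<rho> \<subseteq> insert l T"
        using y(1,2) unfolding face_chain_def by blast+
      ultimately show ?thesis by auto
    qed
    show "\<exists>y. face_chain U b (Suc i) y \<and> (\<forall>\<tau>. y \<tau> \<noteq> 0 \<longrightarrow> \<tau> \<subseteq> T) \<and> face_boundary y = z"
    proof (cases "lookup b l = 0")
      \<comment> \<open>Start of the descent: x_l does not divide the multidegree, so no face
        contains \<open>l\<close>.\<close>
      case True
      then have "l \<notin> keys b" by (simp add: in_keys_iff)
      then have "y1 \<rho> = 0" for \<rho> using y1_face[of \<rho>] by blast
      then have "face_boundary y0 = z" using z_eq by (simp add: fun_eq_iff)
      with y0 show ?thesis by blast
    next
      case False
      let ?b = "b - single l 1"
      have b: "lookup ?b k = (if k = l then lookup b k - 1 else lookup b k)" for k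
        by (auto simp: lookup_minus lookup_single when_def)
      have "face_chain U ?b i y1"
        unfolding face_chain_def
      proof (intro allI impI)
        fix \<rho> assume "y1 \<rho> \<noteq> 0"
        note \<rho> = y1_face[OF this]
        have "?b - squarefree \<rho> = b - squarefree (insert l \<rho>)"
          using \<rho> by (simp add: minus_squarefree_insert diff_diff_add add.commute)
        moreover have "\<rho> \<subseteq> keys ?b" using \<rho> unfolding subset_iff in_keys_iff b by auto
        ultimately show "card \<rho> = i \<and> \<rho> \<subseteq> keys ?b \<and> ?b - squarefree \<rho> \<in> U" using \<rho> by simp
      qed
      moreover have "\<forall>\<tau>. y1 \<tau> \<noteq> 0 \<longrightarrow> \<tau> \<subseteq> T" using y1_face by blast
      moreover have "face_boundary y1 = (\<lambda>_. 0)"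
      proof
        fix \<tau>
        have "face_boundary z \<tau> = face_boundary (face_boundary y0) \<tau> + face_boundary y1 \<tau>"
          unfolding z_eq[abs_def] by (rule face_boundary_add)
        then show "face_boundary y1 \<tau> = 0"
          by (simp add: z(3) face_boundary_face_boundary[OF y0(1)])
      qed
      moreover have "acyclic_on T U ?b i TYPE('k)"
        using less.prems False assms(2) by (intro less.hyps) (auto simp: b simp del: One_nat_def)
      ultimately obtain w where w: "face_chain U ?b (Suc i) w" "\<forall>\<tau>. w \<tau> \<noteq> 0 \<longrightarrow> \<tau> \<subseteq> T" "face_boundary w = y1"
        unfolding acyclic_on_def by blast
      \<comment> \<open>Multiplication by x_l carries the lift of \<open>y1\<close> back to the
        multidegree \<open>b\<close>.\<close>
      have w': "face_chain U b (Suc i) w"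
        unfolding face_chain_def
      proof (intro allI impI)
        fix \<tau> assume "w \<tau> \<noteq> 0"
        then have \<tau>: "card \<tau> = Suc i" "\<tau> \<subseteq> keys ?b" "?b - squarefree \<tau> \<in> U"
          using w(1) unfolding face_chain_def by blast+
        have "?b - squarefree \<tau> \<preceq> b - squarefree \<tau>"
          by (auto simp: divides_def lookup_minus intro: diff_le_mono diff_le_self)
        moreover have "keys ?b \<subseteq> keys b"
            by (auto simp: in_keys_iff b simp del: One_nat_def split: if_splits)
        ultimately show "card \<tau> = Suc i \<and> \<tau> \<subseteq> keys b \<and> b - squarefree \<tau> \<in> U"
          using \<tau> upsetD[OF assms(1)] by blast
      qed
      show ?thesis
      proof (intro exI[of _ "\<lambda>\<tau>. y0 \<tau> + w \<tau>"] conjI)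
        show "face_chain U b (Suc i) (\<lambda>\<tau>. y0 \<tau> + w \<tau>)"
          using y0(1) w' unfolding face_chain_def by (metis add_0)
        show "\<forall>\<tau>. y0 \<tau> + w \<tau> \<noteq> 0 \<longrightarrow> \<tau> \<subseteq> T"
          using y0(2) w(2) by (metis add_0)
        show "face_boundary (\<lambda>\<tau>. y0 \<tau> + w \<tau>) = z"
          by (simp add: fun_eq_iff face_boundary_add w(3) z_eq)
      qed
    qed
  qed
qed

text \<open>The variables outside \<open>V\<close> are removed one at a time. Each removal descends
  in the exponent of a variable, so all multidegrees with the prescribed exponents on
  \<open>V\<close> are treated together.\<close>

lemma acyclic_on_of_acyclic_at:
  fixes U :: "('n::{finite,linorder} \<Rightarrow>\<^sub>0 nat) set"
  assumes "upset U"
    and "\<And>b. \<forall>k\<in>V. lookup b k = a k \<Longrightarrow> acyclic_at U b i TYPE('k::field)"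
    and "\<forall>k\<in>V. lookup b k = a k"
  shows "acyclic_on V U b i TYPE('k)"
proof -
  have "acyclic_on (- S) U b i TYPE('k)" if "S \<inter> V = {}" "\<forall>k\<in>V. lookup b k = a k" for S b
    using finite[of S] that
  proof (induction S arbitrary: b rule: finite_induct)
    case empty
    then show ?case using assms(2) by simp
  next
    case (insert l S)
    then have S: "insert l (- insert l S) = - S" "l \<notin> V" "S \<inter> V = {}" by auto
    show ?case
    proof (rule acyclic_on_insertD[OF assms(1) S(2)])
      show "acyclic_on (insert l (- insert l S)) U b i TYPE('k)" if "\<forall>k\<in>V. lookup b k = a k" for b
        unfolding S(1) using insert.IH S(3) that by blast
    qed (use insert.prems in auto)
  qed
  from this[of "- V" b] show ?thesis using assms(3) by simp
qed

section \<open>Homology from an irreducible component\<close>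

text \<open>On the variables of \<open>V\<close>, in the multidegree that is \<open>e\<close> on
  \<open>V\<close> and \<open>w\<close> elsewhere, every proper subset of \<open>V\<close> is a face
  but \<open>V\<close> is not: the boundary of a simplex. Its homology in degree
  \<open>card V - 1\<close> would vanish if all multidegrees equal to \<open>e\<close> on
  \<open>V\<close> were acyclic.\<close>

lemma component_not_acyclic:
  fixes U :: "('n::{finite,linorder} \<Rightarrow>\<^sub>0 nat) set"
  assumes "upset U" "V \<noteq> {}" and e: "\<forall>i\<in>V. 0 < e i" and w: "w \<notin> irreducible_upset V e"
    and inI: "\<And>m. w \<preceq> m \<Longrightarrow> m \<in> irreducible_upset V e \<Longrightarrow> m \<in> U"
    and notinI: "\<And>m. m \<notin> irreducible_upset V e \<Longrightarrow> m \<notin> U"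
  shows "\<exists>b. (\<forall>k\<in>V. lookup b k = e k) \<and> \<not> acyclic_at U b (card V - 1) TYPE('k::field)"
proof (rule ccontr)
  assume "\<not> ?thesis"
  then have acyc: "\<And>b. \<forall>k\<in>V. lookup b k = e k \<Longrightarrow> acyclic_at U b (card V - 1) TYPE('k)"
    by blast
  define b where "b = Abs_poly_mapping (\<lambda>k. if k \<in> V then e k else lookup w k)"
  have b: "lookup b k = (if k \<in> V then e k else lookup w k)" for k
    by (simp add: b_def)
  have V: "V \<subseteq> keys b" "Suc (card V - 1) = card V"
    using e assms(2) by (auto simp: in_keys_iff b card_gt_0_iff)
  have top: "b - squarefree V \<notin> U"
    using e by (intro notinI) (auto simp: irreducible_upset_iff lookup_minus b not_le)
  \<comment> \<open>The full simplex, a chain over \<open>UNIV\<close> but not over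
    \<open>U\<close>; its boundary is the cycle that cannot be lifted.\<close>
  define \<delta> :: "'n set \<Rightarrow> 'k" where "\<delta> \<tau> = (if \<tau> = V then 1 else 0)" for \<tau>
  have \<delta>: "face_chain UNIV b (card V) \<delta>" using V(1) by (auto simp: face_chain_def \<delta>_def)
  have bd: "\<exists>l\<in>V. \<tau> = V - {l}" if "face_boundary \<delta> \<tau> \<noteq> 0" for \<tau>
  proof -
    obtain l where "l \<in> - \<tau>" "koszul_sign l \<tau> * \<delta> (insert l \<tau>) \<noteq> 0"
      using \<open>face_boundary \<delta> \<tau> \<noteq> 0\<close> unfolding face_boundary_def
      by (rule sum.not_neutral_contains_not_neutral)
    then have "insert l \<tau> = V" "l \<notin> \<tau>" by (auto simp: \<delta>_def split: if_splits)
    then show ?thesis by blast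
  qed
  have "face_chain U b (card V - 1) (face_boundary \<delta>)"
    unfolding face_chain_def
  proof (intro allI impI)
    fix \<tau> assume "face_boundary \<delta> \<tau> \<noteq> 0"
    then obtain l where l: "l \<in> V" "\<tau> = V - {l}" using bd by blast
    have "w \<preceq> b - squarefree \<tau>"
      using w e l by (auto simp: divides_def lookup_minus b irreducible_upset_iff not_le less_imp_le)
    moreover have "b - squarefree \<tau> \<in> irreducible_upset V e"
      unfolding irreducible_upset_iff using l by (intro bexI[of _ l]) (simp_all add: lookup_minus b)
    ultimately show "card \<tau> = card V - 1 \<and> \<tau> \<subseteq> keys b \<and> b - squarefree \<tau> \<in> U"
      using inI V(1) l by auto
  qed
  moreover have "\<forall>\<tau>. face_boundary \<delta> \<tau> \<noteq> 0 \<longrightarrow> \<tau> \<subseteq> V" using bd by blast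
  moreover have "face_boundary (face_boundary \<delta>) = (\<lambda>_. 0)"
    by (rule face_boundary_face_boundary[OF \<delta>])
  moreover have "acyclic_on V U b (card V - 1) TYPE('k)"
  proof (rule acyclic_on_of_acyclic_at[OF assms(1)])
    show "acyclic_at U b (card V - 1) TYPE('k)" if "\<forall>k\<in>V. lookup b k = e k" for b
      using that by (rule acyc)
    show "\<forall>k\<in>V. lookup b k = e k" by (simp add: b)
  qed
  ultimately obtain y where y: "face_chain U b (card V) y" "\<forall>\<tau>. y \<tau> \<noteq> 0 \<longrightarrow> \<tau> \<subseteq> V"
      "face_boundary y = face_boundary \<delta>"
    unfolding acyclic_on_def V(2) by blast
  \<comment> \<open>Among subsets of \<open>V\<close> only \<open>V\<close> itself has
    \<open>card V\<close> elements, and it is not a face.\<close>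
  have "y \<tau> = 0" for \<tau>
  proof (rule ccontr)
    assume "y \<tau> \<noteq> 0"
    then have "\<tau> \<subseteq> V" "card \<tau> = card V" "b - squarefree \<tau> \<in> U"
      using y(1,2) unfolding face_chain_def by blast+
    then show False using card_subset_eq[of V \<tau>] top by auto
  qed
  then have zero: "face_boundary \<delta> \<tau> = 0" for \<tau>
    unfolding y(3)[symmetric] by (simp add: face_boundary_def)
  obtain l where l: "l \<in> V" using assms(2) by blast
  have "face_boundary \<delta> (V - {l}) = (\<Sum>k\<in>- (V - {l}). if k = l then koszul_sign l (V - {l}) else 0)"
    unfolding face_boundary_def using l by (intro sum.cong refl) (auto simp: \<delta>_def)
  then have "face_boundary \<delta> (V - {l}) = koszul_sign l (V - {l})" by simp
  with zero koszul_sign_square[of l "V - {l}", where 'k = 'k] show False by simp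
qed

section \<open>From acyclicity to regularity\<close>

text \<open>Bounds the differences \<open>j - i\<close> below by 0, so that \<open>reg\<close>
  becomes a maximum over a finite set.\<close>

lemma acyclic_at_of_mdeg_less:
  fixes U :: "('n::{finite,linorder} \<Rightarrow>\<^sub>0 nat) set"
  assumes "mdeg b < i" shows "acyclic_at U b i TYPE('k::field)"
  unfolding acyclic_at_iff
proof (intro allI impI)
  fix c :: "'n set \<Rightarrow> 'k" assume c: "face_chain U b i c"
  have "c \<tau> = 0" for \<tau>
  proof (rule ccontr)
    assume "c \<tau> \<noteq> 0"
    then have "card \<tau> = i" "\<tau> \<subseteq> keys b" using c unfolding face_chain_def by blast+
    then show False using mdeg_minus_squarefree[of \<tau> b] assms by simp
  qed
  then have "face_chain U b (Suc i) (\<lambda>_. 0 :: 'k) \<and> face_boundary (\<lambda>_. 0) = c"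
    by (simp add: face_chain_def fun_eq_iff)
  then show "\<exists>y. face_chain U b (Suc i) y \<and> face_boundary y = c" by blast
qed

text \<open>A monomial of least degree is no combination of proper multiples; this makes the set
  under \<open>Max\<close> nonempty.\<close>

lemma minimal_degree_not_acyclic:
  fixes U :: "('n::{finite,linorder} \<Rightarrow>\<^sub>0 nat) set"
  assumes "u \<in> U" and min: "\<And>v. v \<in> U \<Longrightarrow> mdeg u \<le> mdeg v"
  shows "\<not> acyclic_at U u 0 TYPE('k::field)"
proof
  assume acyc: "acyclic_at U u 0 TYPE('k)"
  define c :: "'n set \<Rightarrow> 'k" where "c \<tau> = (if \<tau> = {} then 1 else 0)" for \<tau>
  have "u - squarefree {} = u" by (intro poly_mapping_eqI) (simp add: lookup_minus)
  then have "face_chain U u 0 c" "face_boundary c = (\<lambda>_. 0)"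
    using assms(1) by (auto simp: face_chain_def c_def face_boundary_def)
  then obtain y where y: "face_chain U u (Suc 0) y" "face_boundary y = c"
    using acyc unfolding acyclic_at_iff by blast
  have "y \<tau> = 0" for \<tau>
  proof (rule ccontr)
    assume "y \<tau> \<noteq> 0"
    then have "card \<tau> = Suc 0" "\<tau> \<subseteq> keys u" "u - squarefree \<tau> \<in> U"
      using y(1) unfolding face_chain_def by blast+
    then show False using mdeg_minus_squarefree[of \<tau> u] min[of "u - squarefree \<tau>"] by simp
  qed
  then have "face_boundary y {} = 0" by (simp add: face_boundary_def)
  then show False by (simp add: y(2) c_def)
qed

text \<open>For an upset this says that the truncation of the ideal in degrees
  \<open>\<ge> d\<close> is a stable ideal generated in degree \<open>d\<close>. In the present
  form, closure under intersections is immediate.\<close>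

definition stable_above :: "nat \<Rightarrow> ('n::{finite,linorder} \<Rightarrow>\<^sub>0 nat) set \<Rightarrow> bool" where
  "stable_above d U \<longleftrightarrow> (\<forall>u\<in>U. d < mdeg u \<longrightarrow> u - single (Max (keys u)) 1 \<in> U)"

lemma regularity_set_bounds:
  fixes U :: "('n::{finite,linorder} \<Rightarrow>\<^sub>0 nat) set"
  assumes "upset U" "stable_above d U"
  shows "{int j - int i | i j. betti (monomial_span U :: ('n, 'k::field) mpoly set) i j \<noteq> 0} \<subseteq> {0..int d}"
proof
  fix x assume "x \<in> {int j - int i | i j. betti (monomial_span U :: ('n, 'k) mpoly set) i j \<noteq> 0}"
  then obtain i j where ij: "x = int j - int i" "betti (monomial_span U :: ('n, 'k) mpoly set) i j \<noteq> 0"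
    by blast
  from ij(2) obtain b where b: "mdeg b = j" "\<not> acyclic_at U b i TYPE('k)"
    using betti_nonzeroD[OF assms(1)] by blast
  have "\<not> d + i < mdeg b"
    using b(2) acyclic_at_of_large_degree[OF assms(1), of d i b] assms(2)
    unfolding stable_above_def by blast
  moreover have "\<not> mdeg b < i" using b(2) acyclic_at_of_mdeg_less by blast
  ultimately show "x \<in> {0..int d}" using b(1) ij(1) by auto
qed

lemma reg_le:
  fixes U :: "('n::{finite,linorder} \<Rightarrow>\<^sub>0 nat) set"
  assumes "upset U" "stable_above d U" "U \<noteq> {}"
  shows "reg (monomial_span U :: ('n, 'k::field) mpoly set) \<le> int d"
proof -
  let ?S = "{int j - int i | i j. betti (monomial_span U :: ('n, 'k) mpoly set) i j \<noteq> 0}"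
  obtain u where "u \<in> U" "\<And>v. v \<in> U \<Longrightarrow> mdeg u \<le> mdeg v"
    using assms(3) arg_min_nat_lemma[of "\<lambda>u. u \<in> U" _ mdeg] by blast
  then have "betti (monomial_span U :: ('n, 'k) mpoly set) 0 (mdeg u) \<noteq> 0"
    using minimal_degree_not_acyclic betti_nonzeroI[OF assms(1)] by blast
  then have ne: "?S \<noteq> {}" by blast
  have sub: "?S \<subseteq> {0..int d}" by (rule regularity_set_bounds[OF assms(1,2)])
  then have "Max ?S \<in> ?S" using ne by (intro Max_in finite_subset[OF sub]) simp_all
  then have "Max ?S \<in> {0..int d}" using sub by (rule rev_subsetD)
  then show ?thesis by (simp add: reg_def)
qed

text \<open>The number \<open>d\<close> may be any bound; it makes the set of differences finite, so
  that \<open>Max\<close> is an upper bound.\<close>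

lemma betti_nonzero_le_reg:
  fixes U :: "('n::{finite,linorder} \<Rightarrow>\<^sub>0 nat) set"
  assumes "upset U" "stable_above d U"
    and "betti (monomial_span U :: ('n, 'k::field) mpoly set) i j \<noteq> 0"
  shows "int j - int i \<le> reg (monomial_span U :: ('n, 'k) mpoly set)"
proof -
  let ?S = "{int j - int i | i j. betti (monomial_span U :: ('n, 'k) mpoly set) i j \<noteq> 0}"
  have "finite ?S"
    by (rule finite_subset[OF regularity_set_bounds[OF assms(1,2)]]) simp
  moreover have "int j - int i \<in> ?S" using assms(3) by blast
  ultimately show ?thesis unfolding reg_def by (rule Max_ge)
qed

text \<open>The multidegree found above has degree at least the sum of the \<open>e i\<close>, and
  subtracting the homological degree \<open>card V - 1\<close> leaves the sum of the
  \<open>e i - 1\<close>, plus 1.\<close>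

lemma component_degree_le_reg:
  fixes U :: "('n::{finite,linorder} \<Rightarrow>\<^sub>0 nat) set"
  assumes "upset U" "stable_above d U" "V \<noteq> {}" and e: "\<forall>i\<in>V. 0 < e i"
    and "w \<notin> irreducible_upset V e"
    and "\<And>m. w \<preceq> m \<Longrightarrow> m \<in> irreducible_upset V e \<Longrightarrow> m \<in> U"
    and "\<And>m. m \<notin> irreducible_upset V e \<Longrightarrow> m \<notin> U"
  shows "int (Suc (\<Sum>i\<in>V. e i - 1)) \<le> reg (monomial_span U :: ('n, 'k::field) mpoly set)"
proof -
  obtain b where b: "\<forall>k\<in>V. lookup b k = e k" "\<not> acyclic_at U b (card V - 1) TYPE('k)"
    using component_not_acyclic[OF assms(1,3-7)] by blast
  have "(\<Sum>i\<in>V. e i) = (\<Sum>i\<in>V. Suc (e i - 1))" using e by (intro sum.cong refl) auto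
  then have "(\<Sum>i\<in>V. e i) = (\<Sum>i\<in>V. e i - 1) + card V" by (simp only: sum_Suc)
  moreover have "(\<Sum>i\<in>V. e i) = (\<Sum>i\<in>V. lookup b i)" using b(1) by simp
  moreover have "\<dots> \<le> mdeg b" unfolding mdeg_def by (rule sum_mono2) auto
  moreover have "0 < card V" using assms(3) by (simp add: card_gt_0_iff)
  moreover have "int (mdeg b) - int (card V - 1) \<le> reg (monomial_span U :: ('n, 'k) mpoly set)"
    using betti_nonzeroI[OF assms(1) b(2)] by (rule betti_nonzero_le_reg[OF assms(1,2)])
  ultimately show ?thesis by linarith
qed

section \<open>Primary ideals for initial segments of the variables\<close>

text \<open>With P generated by the variables up to \<open>k\<close>: the unit ideal or a P-primary
  monomial ideal, containing the \<open>d\<close>-th power of P. The middle clause says that minimal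
  generators use only variables up to \<open>k\<close>; it is trivial for x_l not dividing
  \<open>u\<close>, as subtraction is truncated.\<close>

definition initial_primary :: "'n::{finite,linorder} \<Rightarrow> nat \<Rightarrow> ('n \<Rightarrow>\<^sub>0 nat) set \<Rightarrow> bool" where
  "initial_primary k d U \<longleftrightarrow> upset U \<and> (\<forall>u\<in>U. \<forall>l>k. u - single l 1 \<in> U) \<and>
     (\<forall>u. keys u \<subseteq> {..k} \<longrightarrow> d \<le> mdeg u \<longrightarrow> u \<in> U)"

lemma initial_primary_upset: "initial_primary k d U \<Longrightarrow> upset U"
  by (simp add: initial_primary_def)

lemma initial_primary_Inter:
  "(\<And>U. U \<in> \<U> \<Longrightarrow> initial_primary k d U) \<Longrightarrow> initial_primary k d (\<Inter>\<U>)"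
  unfolding initial_primary_def by (intro conjI upset_Inter) blast+

lemma mdeg_minus_single: "0 < lookup u l \<Longrightarrow> Suc (mdeg (u - single l 1)) = mdeg u"
  using mdeg_add_single[of "u - single l 1" l] diff_add_single[of u l] by simp

text \<open>A largest variable beyond \<open>k\<close> can be divided out of any element. Otherwise
  \<open>u\<close> involves only variables up to \<open>k\<close>, and its quotient still has degree
  at least \<open>d\<close>.\<close>

lemma stable_above_initial_primary:
  assumes "initial_primary k d U" shows "stable_above d U"
  unfolding stable_above_def
proof (intro ballI impI)
  fix u assume u: "u \<in> U" "d < mdeg u"
  let ?l = "Max (keys u)"
  have "keys u \<noteq> {}" using u(2) by (auto simp: mdeg_def)
  then have l: "?l \<in> keys u" by simp
  show "u - single ?l 1 \<in> U"
  proof (cases "k < ?l")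
    case True
    then show ?thesis using assms u(1) unfolding initial_primary_def by blast
  next
    case False
    then have "keys u \<subseteq> {..k}" by (auto simp: not_less intro: order_trans[OF Max_ge])
    moreover have "keys (u - single ?l 1) \<subseteq> keys u" by (auto simp: in_keys_iff lookup_minus)
    moreover have "d \<le> mdeg (u - single ?l 1)"
      using u(2) mdeg_minus_single[of u ?l] l by (simp add: in_keys_iff)
    ultimately show ?thesis using assms unfolding initial_primary_def by blast
  qed
qed

text \<open>A monomial in the variables up to \<open>k\<close> outside the ideal has exponents at
  most \<open>e i - 1\<close>, so its degree stays below \<open>d\<close>.\<close>

lemma initial_primary_irreducible_upset:
  assumes e: "\<forall>i\<in>{..k}. 0 < e i" and d: "Suc (\<Sum>i\<le>k. e i - 1) \<le> d"
  shows "initial_primary k d (irreducible_upset {..k} e)"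
  unfolding initial_primary_def
proof (intro conjI ballI allI impI)
  fix u l assume "u \<in> irreducible_upset {..k} e" "k < l"
  then obtain i where "i \<le> k" "e i \<le> lookup u i" "i \<noteq> l"
    by (auto simp: irreducible_upset_iff)
  then show "u - single l 1 \<in> irreducible_upset {..k} e"
    unfolding irreducible_upset_iff
    by (intro bexI[of _ i]) (simp_all add: lookup_minus lookup_single)
next
  fix u :: "'a \<Rightarrow>\<^sub>0 nat" assume u: "keys u \<subseteq> {..k}" "d \<le> mdeg u"
  show "u \<in> irreducible_upset {..k} e"
  proof (rule ccontr)
    assume "u \<notin> irreducible_upset {..k} e"
    then have "lookup u i \<le> e i - 1" if "i \<le> k" for i
      using that by (force simp: irreducible_upset_iff)
    then have "(\<Sum>i\<le>k. lookup u i) \<le> (\<Sum>i\<le>k. e i - 1)" by (intro sum_mono) simp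
    moreover have "mdeg u = (\<Sum>i\<le>k. lookup u i)"
      unfolding mdeg_def using u(1)
          by (intro sum.mono_neutral_right) (auto simp: in_keys_iff subset_iff)
    ultimately show False using d u(2) by simp
  qed
qed (rule upset_irreducible_upset)

lemma exists_divisor_of_mdeg:
  "d \<le> mdeg m \<Longrightarrow> \<exists>a. a \<preceq> m \<and> mdeg a = d"
proof (induction d)
  case 0
  then show ?case by (intro exI[of _ 0]) (simp add: divides_def mdeg_def)
next
  case (Suc d)
  then obtain a where a: "a \<preceq> m" "mdeg a = d" by auto
  have "\<exists>l. lookup a l < lookup m l"
  proof (rule ccontr)
    assume "\<not> ?thesis"
    then have "mdeg m \<le> mdeg a" unfolding mdeg_def by (intro sum_mono) (simp add: not_less)
    with a(2) Suc.prems show False by simp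
  qed
  then obtain l where "lookup a l < lookup m l" ..
  with a(1) have "a + single l 1 \<preceq> m"
    by (auto simp: divides_def lookup_add lookup_single when_def Suc_leI)
  moreover have "mdeg (a + single l 1) = Suc d" by (simp only: mdeg_add_single a(2))
  ultimately show ?case by blast
qed

text \<open>A monomial of degree at least \<open>d + d'\<close> splits into a factor of degree
  \<open>d\<close> and a rest of degree at least \<open>d'\<close>; a variable beyond
  \<open>k\<close> can be divided out of one of the two factors.\<close>

lemma initial_primary_sumset:
  assumes "initial_primary k d U" "initial_primary k d' W"
  shows "initial_primary k (d + d') (sumset U W)"
  unfolding initial_primary_def
proof (intro conjI ballI allI impI)
  show "upset (sumset U W)" by (rule upset_sumset[OF initial_primary_upset[OF assms(2)]])
next
  fix v l assume "v \<in> sumset U W" and l: "k < l"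
  then obtain u w where v: "v = u + w" "u \<in> U" "w \<in> W" by (auto simp: sumset_def)
  have "v - single l 1 = (u - single l 1) + w \<or> v - single l 1 = u + (w - single l 1)"
  proof (cases "lookup u l = 0")
    case True
    then show ?thesis
      by (intro disjI2 poly_mapping_eqI)
        (auto simp: v(1) lookup_add lookup_minus lookup_single when_def)
  next
    case False
    then show ?thesis
      by (intro disjI1 poly_mapping_eqI)
        (auto simp: v(1) lookup_add lookup_minus lookup_single when_def)
  qed
  moreover have "u - single l 1 \<in> U" "w - single l 1 \<in> W"
    using assms v(2,3) l unfolding initial_primary_def by blast+
  ultimately show "v - single l 1 \<in> sumset U W"
    using v(2,3) unfolding sumset_def by blast
next
  fix m :: "'a \<Rightarrow>\<^sub>0 nat" assume m: "keys m \<subseteq> {..k}" "d + d' \<le> mdeg m"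
  then obtain a where a: "a \<preceq> m" "mdeg a = d" using exists_divisor_of_mdeg[of d m] by auto
  have m_eq: "m = a + (m - a)" by (rule dividesD[OF a(1)])
  have "mdeg m = mdeg a + mdeg (m - a)" by (subst m_eq) (rule mdeg_add)
  then have "d' \<le> mdeg (m - a)" using m(2) a(2) by simp
  moreover have "keys a \<subseteq> keys m"
    using a(1) unfolding divides_def in_keys_iff subset_iff by (metis le_zero_eq)
  moreover have "keys (m - a) \<subseteq> keys m" by (auto simp: in_keys_iff lookup_minus)
  ultimately have "a \<in> U" "m - a \<in> W"
    using assms m(1) a(2) unfolding initial_primary_def by auto
  with m_eq show "m \<in> sumset U W" unfolding sumset_def by blast
qed

lemma initial_primary_sumset_power:
  assumes "initial_primary k d U" shows "initial_primary k (q * d) (sumset_power U q)"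
proof (induction q)
  case 0
  then show ?case by (simp add: initial_primary_def)
next
  case (Suc q)
  then show ?case using initial_primary_sumset[OF assms] by simp
qed

lemma stable_above_Inter:
  "(\<And>U. U \<in> \<U> \<Longrightarrow> stable_above d U) \<Longrightarrow> stable_above d (\<Inter>\<U>)"
  unfolding stable_above_def by blast

section \<open>Regularity of quasi-symbolic powers\<close>

theorem theorem2p4:
  fixes I :: "('n::{finite,linorder}, 'k::field) mpoly set" and q :: nat
  assumes "infinite (UNIV :: 'k set)"
    and "CARD('n) \<ge> 2"
    and "monomial_ideal I" and "I \<noteq> {0}" and "I \<noteq> UNIV"
    and "borel_type I"
    and "q > 0"
  shows "reg (quasi_symbolic_power I q) \<le> int q * reg I"
proof -
  let ?\<C> = "irreducible_components I"
  obtain U where U: "upset U" "I = monomial_span U" using assms(3) by (rule monomial_idealE)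
  have dec: "finite ?\<C>" "\<Inter>?\<C> = I"
    using irredundant_decomposition_irreducible_components[OF assms(3)]
    by (auto simp: irredundant_decomposition_def)
  then have "?\<C> \<noteq> {}" using assms(5) by auto
  define comp where "comp C k e w \<longleftrightarrow>
      C = (monomial_span (irreducible_upset {..k} e) :: ('n, 'k) mpoly set) \<and> (\<forall>i\<in>{..k}. 0 < e i) \<and>
      w \<notin> irreducible_upset {..k} e \<and>
      (\<forall>m. w \<preceq> m \<longrightarrow> m \<in> irreducible_upset {..k} e \<longrightarrow> m \<in> U) \<and>
      (\<forall>m. m \<notin> irreducible_upset {..k} e \<longrightarrow> m \<notin> U)" for C k e w
  have "\<exists>k e w. comp C k e w" if C: "C \<in> ?\<C>" for C
  proof (rule irreducible_componentE[OF assms(3) C])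
    fix V e w
    assume *: "C = monomial_span (irreducible_upset V e)" "\<forall>i\<in>V. 0 < e i" "w \<notin> irreducible_upset V e"
      "\<And>m. w \<preceq> m \<Longrightarrow> m \<in> irreducible_upset V e \<Longrightarrow> monomial m \<in> I"
      "\<And>m. m \<notin> irreducible_upset V e \<Longrightarrow> monomial m \<notin> I"
    \<comment> \<open>The empty set of variables would give the zero ideal and force
      \<open>I = {0}\<close>; nonemptiness also makes \<open>Max V\<close> meaningful.\<close>
    have "V \<noteq> {}"
    proof
      assume "V = {}"
      then have "C = {0}" by (auto simp: *(1) irreducible_upset_def monomial_span_def)
      moreover have "I \<subseteq> C" using dec(2) C by blast
      ultimately show False using assms(4) U(2) zero_in_monomial_span[of U] by blast
    qed
    have "V = {..Max V}"
    proof
      show "V \<subseteq> {..Max V}" by auto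
      show "{..Max V} \<subseteq> V"
        using borel_type_component_variables[OF assms(6), of V e "Max V"] C *(1,2) \<open>V \<noteq> {}\<close>
        by auto
    qed
    with * U(2) have "comp C (Max V) e w" unfolding comp_def by simp
    then show ?thesis by blast
  qed
  then obtain k e w where "\<And>C. C \<in> ?\<C> \<Longrightarrow> comp C (k C) (e C) (w C)"
    by metis
  then have comp: "\<And>C. C \<in> ?\<C> \<Longrightarrow> C = monomial_span (irreducible_upset {..k C} (e C))"
      "\<And>C. C \<in> ?\<C> \<Longrightarrow> \<forall>i\<in>{..k C}. 0 < e C i"
      "\<And>C. C \<in> ?\<C> \<Longrightarrow> w C \<notin> irreducible_upset {..k C} (e C)"
      "\<And>C m. C \<in> ?\<C> \<Longrightarrow> w C \<preceq> m \<Longrightarrow> m \<in> irreducible_upset {..k C} (e C) \<Longrightarrow> m \<in> U"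
      "\<And>C m. C \<in> ?\<C> \<Longrightarrow> m \<notin> irreducible_upset {..k C} (e C) \<Longrightarrow> m \<notin> U"
    unfolding comp_def by simp_all
  define W where "W C = irreducible_upset {..k C} (e C)" for C
  have W: "C = monomial_span (W C)" if "C \<in> ?\<C>" for C using comp(1)[OF that] by (simp add: W_def)
  have "(monomial_span U :: ('n, 'k) mpoly set) = monomial_span (\<Inter>(W ` ?\<C>))"
    using dec(2) W U(2) unfolding monomial_span_Inter by auto
  then have U_eq: "U = \<Inter>(W ` ?\<C>)" by (simp add: monomial_span_eq_iff)
  define \<nu> where "\<nu> C = Suc (\<Sum>i\<le>k C. e C i - 1)" for C
  \<comment> \<open>A crude common bound for all \<open>\<nu> C\<close>. It only shows that
    \<open>reg I\<close> is a maximum over a finite set, which the lower bound needs.\<close>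
  define D where "D = (\<Sum>C\<in>?\<C>. \<nu> C)"
  have "stable_above D U"
    unfolding U_eq
  proof (rule stable_above_Inter)
    fix U' assume "U' \<in> W ` ?\<C>"
    then obtain C where C: "C \<in> ?\<C>" "U' = W C" by blast
    have "\<nu> C \<le> D" unfolding D_def by (rule member_le_sum) (use C dec(1) in auto)
    then have "initial_primary (k C) D U'"
      unfolding C(2) W_def \<nu>_def by (rule initial_primary_irreducible_upset[OF comp(2)[OF C(1)]])
    then show "stable_above D U'" by (rule stable_above_initial_primary)
  qed
  then have \<nu>: "int (\<nu> C) \<le> reg I" if "C \<in> ?\<C>" for C
    unfolding U(2) \<nu>_def
    by (rule component_degree_le_reg[OF U(1), where w = "w C"]) (use comp that in auto)
  \<comment> \<open>\<open>reg I\<close> is at least some \<open>\<nu> C\<close>, hence positive, so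
    \<open>nat\<close> loses nothing.\<close>
  define d where "d = nat (reg I)"
  have d: "int d = reg I" using \<nu> \<open>?\<C> \<noteq> {}\<close> unfolding d_def by force
  have primary: "initial_primary (k C) d (W C)" if "C \<in> ?\<C>" for C
  proof -
    have "\<nu> C \<le> d" using \<nu>[OF that] d by linarith
    then show ?thesis
      unfolding W_def \<nu>_def by (rule initial_primary_irreducible_upset[OF comp(2)[OF that]])
  qed
  \<comment> \<open>Intersecting components of equal radical within \<open>initial_primary\<close>
    requires a common \<open>k\<close>.\<close>
  have k_eq: "k C = k C'" if "C \<in> ?\<C>" "C' \<in> ?\<C>" "radical C = radical C'" for C C'
  proof -
    have in_rad: "i \<in> {..k C} \<longleftrightarrow> var i \<in> radical C" if "C \<in> ?\<C>" for i C
      using var_in_radical_iff[OF comp(2)[OF that]] comp(1)[OF that] by metis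
    have "{..k C} = {..k C'}"
    proof (rule set_eqI)
      show "i \<in> {..k C} \<longleftrightarrow> i \<in> {..k C'}" for i
        using in_rad[OF that(1), of i] in_rad[OF that(2), of i] that(3) by simp
    qed
    then show ?thesis by simp
  qed
  \<comment> \<open>The exponent set of the canonical component with the radical of
    \<open>C\<close>. It is indexed by components, so the same set may occur several times, which
    does not affect the intersection.\<close>
  define N where "N C = \<Inter>(W ` {C' \<in> ?\<C>. radical C' = radical C})" for C
  have N: "initial_primary (k C) d (N C)" if "C \<in> ?\<C>" for C
    unfolding N_def
  proof (rule initial_primary_Inter)
    fix U' assume "U' \<in> W ` {C' \<in> ?\<C>. radical C' = radical C}"
    then obtain C' where C': "C' \<in> ?\<C>" "radical C' = radical C" "U' = W C'" by blast
    show "initial_primary (k C) d U'"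
      using primary[OF C'(1)] k_eq[OF C'(1) that C'(2)] C'(3) by simp
  qed
  have "\<Inter>{C' \<in> ?\<C>. radical C' = radical C} = monomial_span (N C)" for C
    unfolding N_def monomial_span_Inter image_image
        by (rule arg_cong[of _ _ Inter]) (use W in force)
  then have "quasi_symbolic_power I q = (\<Inter>C\<in>?\<C>. ideal_power (monomial_span (N C)) q)"
    unfolding quasi_symbolic_power_def canonical_presentation_def by simp
  then have qsp: "quasi_symbolic_power I q = monomial_span (\<Inter>C\<in>?\<C>. sumset_power (N C) q)"
    by (simp add: ideal_power_monomial_span monomial_span_Inter image_image)
  have power: "initial_primary (k C) (q * d) (sumset_power (N C) q)" if "C \<in> ?\<C>" for C
    by (rule initial_primary_sumset_power[OF N[OF that]])
  \<comment> \<open>A common multiple of the powers of x_(k C) with exponent \<open>q * d\<close>;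
    it shows that the intersection is nonempty, as \<open>reg_le\<close> requires.\<close>
  define m where "m = Abs_poly_mapping (\<lambda>_ :: 'n. q * d)"
  have "m \<in> sumset_power (N C) q" if "C \<in> ?\<C>" for C
  proof -
    have "single (k C) (q * d) \<in> sumset_power (N C) q"
      using power[OF that] by (auto simp: initial_primary_def mdeg_def lookup_single when_def)
    moreover have "single (k C) (q * d) \<preceq> m"
      by (simp add: divides_def m_def lookup_single when_def)
    ultimately show ?thesis using upsetD[OF upset_sumset_power] by blast
  qed
  then have "(\<Inter>C\<in>?\<C>. sumset_power (N C) q) \<noteq> {}" by blast
  moreover have "upset (\<Inter>C\<in>?\<C>. sumset_power (N C) q)"
    by (rule upset_Inter) (auto simp: upset_sumset_power)
  moreover have "stable_above (q * d) (\<Inter>C\<in>?\<C>. sumset_power (N C) q)"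
    by (rule stable_above_Inter) (auto dest: power intro: stable_above_initial_primary)
  ultimately have "reg (quasi_symbolic_power I q) \<le> int (q * d)"
    unfolding qsp by (intro reg_le)
  then show ?thesis by (simp add: d)
qed

end
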